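(* Let $\lambda$ be a cardinal with $\lambda > \operatorname{cf}(\lambda) = \kappa > \aleph_0$. For every nonzero cardinal $\mu \leq \lambda$ there is an inverse $\kappa$-system $\mathcal{A} = \langle G_i, h_{i,j} \mid i<j<\kappa\rangle$ of abelian groups such that $|G_i| < \lambda$ for every $i<\kappa$ and $|\mathrm{Gr}(\mathcal{A})/\mathrm{Fact}(\mathcal{A})| = \mu$. The same conclusion holds also for every cardinal $\mu$ with $\lambda < \mu \leq \lambda^{\kappa}$, under the assumption that $2^{\kappa} < \lambda$ and $\theta^{<\kappa} < \lambda$ for every cardinal $\theta < \lambda$.
   Context: For a limit ordinal $\gamma$, an inverse $\gamma$-system of abelian groups is a family $\mathcal{A} = \langle G_i, h_{i,j} \mid i<j<\gamma\rangle$ where each $G_i$ ($i<\gamma$) is an additive abelian group, each $h_{i,j} : G_j \to G_i$ ($i<j<\gamma$) is a group homomorphism, and $h_{i,j}\circ h_{j,k} = h_{i,k}$ for all $i<j<k<\gamma$. Define $$\mathrm{Gr}(\mathcal{A}) = \{ \langle a_{i,j} \mid i<j<\gamma\rangle : a_{i,j}\in G_i \text{ and } a_{i,k} = a_{i,j} + h_{i,j}(a_{j,k}) \text{ for all } i<j<k<\gamma \},$$ $$\mathrm{Fact}(\mathcal{A}) = \{ \langle a_{i,j} \mid i<j<\gamma\rangle : \text{for some } \bar y = \langle y_i\mid i<\gamma\rangle \in \textstyle\prod_{k<\gamma} G_k,\ a_{i,j} = y_i - h_{i,j}(y_j) \text{ for all } i<j<\gamma \}.$$ Both are abelian groups under pointwise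 addition, and $\mathrm{Fact}(\mathcal{A}) \subseteq \mathrm{Gr}(\mathcal{A})$. The factor group $\mathrm{Gr}(\mathcal{A})/\mathrm{Fact}(\mathcal{A})$ is called the quotient limit of $\mathcal{A}$. For cardinals, $\theta^{<\kappa} = \sup\{\theta^{\nu} : \nu<\kappa \text{ a cardinal}\}$. *)

theory Defs
  imports "HOL-Algebra.Product_Groups"
begin

unbundle cardinal_syntax

text \<open>
  Cardinals are relations satisfying \<^term>\<open>Card_order\<close>: well-orders of minimal order type, that is,
  initial ordinals up to isomorphism. They are compared by \<open>=o\<close>, \<open>\<le>o\<close>, \<open><o\<close>, also across types.
\<close>

subsection \<open>Cofinality\<close>

text \<open>
  The library's \<^term>\<open>cofinal\<close> asks for a strictly larger element of \<open>A\<close> above every element; for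
  a cardinal this is the usual notion exactly when the cardinal is infinite (or empty), and only
  then is \<open>cf\<close> meaningful.
\<close>

definition cf :: "'a rel \<Rightarrow> 'a rel" where
  "cf r = (SOME c. \<exists>A. A \<subseteq> Field r \<and> cofinal A r \<and> c = |A| \<and>
                      (\<forall>B. B \<subseteq> Field r \<and> cofinal B r \<longrightarrow> |A| \<le>o |B| ))"

lemma cf_cofinal:
  assumes "Card_order r" and "infinite (Field r)"
  shows "\<exists>A. A \<subseteq> Field r \<and> cofinal A r \<and> cf r = |A| \<and>
             (\<forall>B. B \<subseteq> Field r \<and> cofinal B r \<longrightarrow> |A| \<le>o |B| )"
proof -
  let ?C = "{ |A| | A. A \<subseteq> Field r \<and> cofinal A r}"
  have "cofinal (Field r) r"
    unfolding cofinal_def using infinite_Card_order_limit[OF assms] by blast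
  then have ne: "?C \<noteq> {}" by blast
  have "\<forall>c\<in>?C. Card_order c" using card_of_Card_order by blast
  from exists_minim_Card_order[OF ne this]
  obtain c where c: "c \<in> ?C" "\<forall>d\<in>?C. c \<le>o d" by blast
  then obtain A where "A \<subseteq> Field r" "cofinal A r" "c = |A|" by blast
  with c(2) have "\<exists>c A. A \<subseteq> Field r \<and> cofinal A r \<and> c = |A| \<and>
                  (\<forall>B. B \<subseteq> Field r \<and> cofinal B r \<longrightarrow> |A| \<le>o |B| )"
    by blast
  then show ?thesis unfolding cf_def by (rule someI_ex)
qed

subsection \<open>Suprema of cardinals and weak powers\<close>

text \<open>
  For a set of cardinals on one type the least upper bound exists on that same type, and it is
  then least among the upper bounds on all types.
\<close>

definition csup :: "'a rel set \<Rightarrow> 'a rel" where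
  "csup S = (SOME c. Card_order c \<and> (\<forall>s\<in>S. s \<le>o c) \<and>
                     (\<forall>d :: 'a rel. Card_order d \<and> (\<forall>s\<in>S. s \<le>o d) \<longrightarrow> c \<le>o d))"

lemma csup_aux:
  fixes S :: "'a rel set"
  assumes "\<And>s. s \<in> S \<Longrightarrow> Card_order s"
  shows "Card_order (csup S) \<and> (\<forall>s\<in>S. s \<le>o csup S) \<and>
         (\<forall>d :: 'a rel. Card_order d \<and> (\<forall>s\<in>S. s \<le>o d) \<longrightarrow> csup S \<le>o d)"
proof -
  let ?C = "{d :: 'a rel. Card_order d \<and> (\<forall>s\<in>S. s \<le>o d)}"
  have "s \<le>o |UNIV :: 'a set|" if "s \<in> S" for s
    by (rule ordIso_ordLeq_trans[OF ordIso_symmetric[OF card_of_Field_ordIso]])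
      (use assms that in \<open>auto intro: card_of_mono1\<close>)
  then have "|UNIV :: 'a set| \<in> ?C" by (simp add: card_of_Card_order)
  then have ne: "?C \<noteq> {}" by blast
  have "\<forall>c\<in>?C. Card_order c" by blast
  from exists_minim_Card_order[OF ne this]
  have "\<exists>c :: 'a rel. Card_order c \<and> (\<forall>s\<in>S. s \<le>o c) \<and>
            (\<forall>d :: 'a rel. Card_order d \<and> (\<forall>s\<in>S. s \<le>o d) \<longrightarrow> c \<le>o d)"
    by blast
  then show ?thesis unfolding csup_def by (rule someI_ex)
qed

lemma Card_order_csup: "(\<And>s. s \<in> S \<Longrightarrow> Card_order s) \<Longrightarrow> Card_order (csup S)"
  using csup_aux by blast

lemma csup_upper: "(\<And>s. s \<in> S \<Longrightarrow> Card_order s) \<Longrightarrow> s \<in> S \<Longrightarrow> s \<le>o csup S"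
  using csup_aux by blast

lemma csup_least:
  fixes S :: "'a rel set" and d :: "'b rel"
  assumes S: "\<And>s. s \<in> S \<Longrightarrow> Card_order s"
    and d: "Card_order d" and ub: "\<And>s. s \<in> S \<Longrightarrow> s \<le>o d"
  shows "csup S \<le>o d"
proof -
  have c: "Card_order (csup S)" using Card_order_csup S by blast
  consider "d \<le>o csup S" | "csup S \<le>o d"
    using ordLeq_total[of d "csup S"] c d by (auto simp: card_order_on_def)
  then show ?thesis
  proof cases
    case 1
    then have "|Field d| \<le>o csup S"
      using card_of_Field_ordIso[OF d] ordIso_ordLeq_trans by blast
    then obtain A :: "'a set" where A: "|Field d| =o |A|"
      using internalize_card_of_ordLeq[of "Field d" "csup S"] by blast
    have dA: "d =o |A|"
      using A card_of_Field_ordIso[OF d] ordIso_symmetric ordIso_transitive by blast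
    then have "\<forall>s\<in>S. s \<le>o |A|" using ub ordLeq_ordIso_trans by blast
    then have "csup S \<le>o |A|" using csup_aux[of S] S card_of_Card_order by blast
    then show ?thesis using dA ordIso_symmetric ordLeq_ordIso_trans by blast
  qed
qed

text \<open>
  \<open>\<theta>\<^bsup><\<kappa>\<^esup>\<close>. Every cardinal below \<open>k\<close> is isomorphic to one on the type of \<open>k\<close>, so ranging over
  that type loses nothing.
\<close>

definition cexp_less :: "'a rel \<Rightarrow> 'k rel \<Rightarrow> ('k \<Rightarrow> 'a) rel" where
  "cexp_less t k = csup {t ^c n | n :: 'k rel. Card_order n \<and> n <o k}"

subsection \<open>Inverse systems and the quotient limit\<close>

text \<open>
  The index ordinal is a well-order \<open>I\<close>, and \<open>i < j\<close> is \<open>(i, j) \<in> I - Id\<close>. The abelian groups are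
  written multiplicatively, as \<open>comm_group\<close> requires. All carriers lie in one type; groups of
  cardinality below a cardinal on that type always have isomorphic copies there.
\<close>

locale inverse_system =
  fixes I :: "'i rel" and G :: "'i \<Rightarrow> 'a monoid" and h :: "'i \<Rightarrow> 'i \<Rightarrow> 'a \<Rightarrow> 'a"
  assumes well_order: "Well_order I"
    and nonempty: "Field I \<noteq> {}"
    and limit: "i \<in> Field I \<Longrightarrow> \<exists>j. (i, j) \<in> I - Id"
    and comm_group: "i \<in> Field I \<Longrightarrow> comm_group (G i)"
    and hom: "(i, j) \<in> I - Id \<Longrightarrow> h i j \<in> hom (G j) (G i)"
    and comp: "(i, j) \<in> I - Id \<Longrightarrow> (j, k) \<in> I - Id \<Longrightarrow> x \<in> carrier (G k) \<Longrightarrow>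
                 h i j (h j k x) = h i k x"

definition pair_product :: "'i rel \<Rightarrow> ('i \<Rightarrow> 'a monoid) \<Rightarrow> ('i \<times> 'i \<Rightarrow> 'a) monoid" where
  "pair_product I G = product_group (I - Id) (\<lambda>(i, j). G i)"

definition Gr ::
  "'i rel \<Rightarrow> ('i \<Rightarrow> 'a monoid) \<Rightarrow> ('i \<Rightarrow> 'i \<Rightarrow> 'a \<Rightarrow> 'a) \<Rightarrow> ('i \<times> 'i \<Rightarrow> 'a) set" where
  "Gr I G h = {a \<in> carrier (pair_product I G).
     \<forall>i j k. (i, j) \<in> I - Id \<and> (j, k) \<in> I - Id \<longrightarrow>
       a (i, k) = a (i, j) \<otimes>\<^bsub>G i\<^esub> h i j (a (j, k))}"

definition Fact ::
  "'i rel \<Rightarrow> ('i \<Rightarrow> 'a monoid) \<Rightarrow> ('i \<Rightarrow> 'i \<Rightarrow> 'a \<Rightarrow> 'a) \<Rightarrow> ('i \<times> 'i \<Rightarrow> 'a) set" where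
  "Fact I G h = {a \<in> carrier (pair_product I G).
     \<exists>y \<in> (\<Pi>\<^sub>E i \<in> Field I. carrier (G i)).
       \<forall>i j. (i, j) \<in> I - Id \<longrightarrow> a (i, j) = y i \<otimes>\<^bsub>G i\<^esub> inv\<^bsub>G i\<^esub> (h i j (y j))}"

definition quotient_limit ::
  "'i rel \<Rightarrow> ('i \<Rightarrow> 'a monoid) \<Rightarrow> ('i \<Rightarrow> 'i \<Rightarrow> 'a \<Rightarrow> 'a) \<Rightarrow> ('i \<times> 'i \<Rightarrow> 'a) set monoid" where
  "quotient_limit I G h = (pair_product I G)\<lparr>carrier := Gr I G h\<rparr> Mod Fact I G h"

context inverse_system
begin

lemma lt_Field: "(i, j) \<in> I - Id \<Longrightarrow> i \<in> Field I \<and> j \<in> Field I"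
  by (auto simp: Field_def)

lemma lt_trans: "(i, j) \<in> I - Id \<Longrightarrow> (j, k) \<in> I - Id \<Longrightarrow> (i, k) \<in> I - Id"
  using well_order unfolding well_order_on_def linear_order_on_def partial_order_on_def
    preorder_on_def trans_def antisym_def by blast

lemma group_pair_product: "group (pair_product I G)"
  unfolding pair_product_def
  by (rule product_group) (use lt_Field comm_group in \<open>auto simp: comm_group_def\<close>)

lemma pair_productD: "a \<in> carrier (pair_product I G) \<Longrightarrow> (i, j) \<in> I - Id \<Longrightarrow> a (i, j) \<in> carrier (G i)"
  unfolding pair_product_def by (auto simp: PiE_iff dest!: bspec[of _ _ "(i, j)"])

lemma mult_pair_product:
  "(i, j) \<in> I - Id \<Longrightarrow> (a \<otimes>\<^bsub>pair_product I G\<^esub> b) (i, j) = a (i, j) \<otimes>\<^bsub>G i\<^esub> b (i, j)"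
  unfolding pair_product_def by simp

lemma one_pair_product: "(i, j) \<in> I - Id \<Longrightarrow> \<one>\<^bsub>pair_product I G\<^esub> (i, j) = \<one>\<^bsub>G i\<^esub>"
  unfolding pair_product_def by simp

lemma inv_pair_product:
  assumes "a \<in> carrier (pair_product I G)" "(i, j) \<in> I - Id"
  shows "(inv\<^bsub>pair_product I G\<^esub> a) (i, j) = inv\<^bsub>G i\<^esub> (a (i, j))"
proof -
  have "inv\<^bsub>pair_product I G\<^esub> a = (\<lambda>p\<in>I - Id. inv\<^bsub>(case p of (i, j) \<Rightarrow> G i)\<^esub> a p)"
    using assms(1) unfolding pair_product_def
    by (subst inv_product_group) (use lt_Field comm_group in \<open>auto simp: comm_group_def\<close>)
  then show ?thesis using assms(2) by simp
qed

lemma comm_group_pair_product: "comm_group (pair_product I G)"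
proof (rule group.group_comm_groupI[OF group_pair_product])
  fix a b assume "a \<in> carrier (pair_product I G)" "b \<in> carrier (pair_product I G)"
  then have "\<forall>p \<in> I - Id. a p \<otimes>\<^bsub>(case p of (i, j) \<Rightarrow> G i)\<^esub> b p = b p \<otimes>\<^bsub>(case p of (i, j) \<Rightarrow> G i)\<^esub> a p"
    using comm_group lt_Field pair_productD
    by (auto intro!: comm_monoid.m_comm simp: comm_group_def)
  then show "a \<otimes>\<^bsub>pair_product I G\<^esub> b = b \<otimes>\<^bsub>pair_product I G\<^esub> a"
    unfolding pair_product_def by (auto intro!: restrict_ext dest: bspec)
qed

lemma group: "i \<in> Field I \<Longrightarrow> group (G i)"
  using comm_group by (simp add: comm_group_def)

lemma group_hom: "(i, j) \<in> I - Id \<Longrightarrow> group_hom (G j) (G i) (h i j)"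
  using hom group lt_Field by (auto simp: group_hom_def group_hom_axioms_def)

lemma subgroup_Gr: "subgroup (Gr I G h) (pair_product I G)"
proof -
  interpret P: group "pair_product I G" by (rule group_pair_product)
  show ?thesis
  proof (rule P.subgroupI)
    show "Gr I G h \<subseteq> carrier (pair_product I G)" by (auto simp: Gr_def)
    have "\<one>\<^bsub>pair_product I G\<^esub> (i, k) =
          \<one>\<^bsub>pair_product I G\<^esub> (i, j) \<otimes>\<^bsub>G i\<^esub> h i j (\<one>\<^bsub>pair_product I G\<^esub> (j, k))"
      if "(i, j) \<in> I - Id" "(j, k) \<in> I - Id" for i j k
    proof -
      interpret H: group_hom "G j" "G i" "h i j" by (rule group_hom) fact
      show ?thesis using that lt_trans[OF that] by (simp only: one_pair_product) simp
    qed
    then have "\<one>\<^bsub>pair_product I G\<^esub> \<in> Gr I G h" by (auto simp: Gr_def)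
    then show "Gr I G h \<noteq> {}" by blast
  next
    fix a assume a: "a \<in> Gr I G h"
    then have aP: "a \<in> carrier (pair_product I G)" by (simp add: Gr_def)
    have "(inv\<^bsub>pair_product I G\<^esub> a) (i, k) =
          (inv\<^bsub>pair_product I G\<^esub> a) (i, j) \<otimes>\<^bsub>G i\<^esub> h i j ((inv\<^bsub>pair_product I G\<^esub> a) (j, k))"
      if ij: "(i, j) \<in> I - Id" and jk: "(j, k) \<in> I - Id" for i j k
    proof -
      interpret H: group_hom "G j" "G i" "h i j" by (rule group_hom) fact
      interpret C: comm_group "G i" using comm_group lt_Field[OF ij] by blast
      have "a (i, k) = a (i, j) \<otimes>\<^bsub>G i\<^esub> h i j (a (j, k))"
        using a ij jk by (auto simp: Gr_def)
      then show ?thesis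
        using pair_productD[OF aP ij] pair_productD[OF aP jk]
        by (simp only: inv_pair_product[OF aP ij] inv_pair_product[OF aP jk]
            inv_pair_product[OF aP lt_trans[OF ij jk]]) (simp add: C.inv_mult)
    qed
    with aP show "inv\<^bsub>pair_product I G\<^esub> a \<in> Gr I G h" by (auto simp: Gr_def)
  next
    fix a b assume a: "a \<in> Gr I G h" and b: "b \<in> Gr I G h"
    then have aP: "a \<in> carrier (pair_product I G)" and bP: "b \<in> carrier (pair_product I G)"
      by (simp_all add: Gr_def)
    have "(a \<otimes>\<^bsub>pair_product I G\<^esub> b) (i, k) =
          (a \<otimes>\<^bsub>pair_product I G\<^esub> b) (i, j) \<otimes>\<^bsub>G i\<^esub> h i j ((a \<otimes>\<^bsub>pair_product I G\<^esub> b) (j, k))"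
      if ij: "(i, j) \<in> I - Id" and jk: "(j, k) \<in> I - Id" for i j k
    proof -
      interpret H: group_hom "G j" "G i" "h i j" by (rule group_hom) fact
      interpret C: comm_group "G i" using comm_group lt_Field[OF ij] by blast
      have "a (i, k) = a (i, j) \<otimes>\<^bsub>G i\<^esub> h i j (a (j, k))"
        and "b (i, k) = b (i, j) \<otimes>\<^bsub>G i\<^esub> h i j (b (j, k))"
        using a b ij jk by (auto simp: Gr_def)
      then show ?thesis
        using pair_productD[OF aP ij] pair_productD[OF aP jk]
          pair_productD[OF bP ij] pair_productD[OF bP jk]
        by (simp only: mult_pair_product[OF ij] mult_pair_product[OF jk]
            mult_pair_product[OF lt_trans[OF ij jk]]) (simp add: C.m_ac)
    qed
    with aP bP show "a \<otimes>\<^bsub>pair_product I G\<^esub> b \<in> Gr I G h" by (auto simp: Gr_def)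
  qed
qed

lemma Fact_subset_Gr: "Fact I G h \<subseteq> Gr I G h"
proof
  fix a assume "a \<in> Fact I G h"
  then obtain y where aP: "a \<in> carrier (pair_product I G)"
    and y: "y \<in> (\<Pi>\<^sub>E i \<in> Field I. carrier (G i))"
    and a: "\<And>i j. (i, j) \<in> I - Id \<Longrightarrow> a (i, j) = y i \<otimes>\<^bsub>G i\<^esub> inv\<^bsub>G i\<^esub> (h i j (y j))"
    unfolding Fact_def by blast
  have "a (i, k) = a (i, j) \<otimes>\<^bsub>G i\<^esub> h i j (a (j, k))"
    if ij: "(i, j) \<in> I - Id" and jk: "(j, k) \<in> I - Id" for i j k
  proof -
    interpret H: group_hom "G j" "G i" "h i j" by (rule group_hom) fact
    interpret K: group_hom "G k" "G j" "h j k" by (rule group_hom) fact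
    interpret C: comm_group "G i" using comm_group lt_Field[OF ij] by blast
    have m: "y i \<in> carrier (G i)" "y j \<in> carrier (G j)" "y k \<in> carrier (G k)"
      using y lt_Field[OF ij] lt_Field[OF jk] by auto
    have "h i j (y j) \<in> carrier (G i)" "h i k (y k) \<in> carrier (G i)"
      using m comp[OF ij jk m(3)] by (auto simp flip: comp[OF ij jk m(3)])
    moreover have cancel: "inv\<^bsub>G i\<^esub> u \<otimes>\<^bsub>G i\<^esub> (u \<otimes>\<^bsub>G i\<^esub> v) = v"
      if "u \<in> carrier (G i)" "v \<in> carrier (G i)" for u v
      using that by (simp flip: H.H.m_assoc)
    ultimately show ?thesis
      using m comp[OF ij jk m(3)]
      by (simp only: a[OF ij] a[OF jk] a[OF lt_trans[OF ij jk]])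
        (simp add: H.H.m_assoc cancel)
  qed
  with aP show "a \<in> Gr I G h" by (auto simp: Gr_def)
qed

lemma subgroup_Fact: "subgroup (Fact I G h) (pair_product I G)"
proof -
  interpret P: group "pair_product I G" by (rule group_pair_product)
  show ?thesis
  proof (rule P.subgroupI)
    show "Fact I G h \<subseteq> carrier (pair_product I G)" by (auto simp: Fact_def)
    have "\<one>\<^bsub>pair_product I G\<^esub> (i, j) =
          (\<lambda>i\<in>Field I. \<one>\<^bsub>G i\<^esub>) i \<otimes>\<^bsub>G i\<^esub> inv\<^bsub>G i\<^esub> (h i j ((\<lambda>i\<in>Field I. \<one>\<^bsub>G i\<^esub>) j))"
      if "(i, j) \<in> I - Id" for i j
    proof -
      interpret H: group_hom "G j" "G i" "h i j" by (rule group_hom) fact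
      show ?thesis using lt_Field[OF that] by (simp add: one_pair_product[OF that])
    qed
    moreover have "(\<lambda>i\<in>Field I. \<one>\<^bsub>G i\<^esub>) \<in> (\<Pi>\<^sub>E i \<in> Field I. carrier (G i))"
      using group by (auto intro: monoid.one_closed group.is_monoid)
    ultimately have "\<one>\<^bsub>pair_product I G\<^esub> \<in> Fact I G h" unfolding Fact_def by blast
    then show "Fact I G h \<noteq> {}" by blast
  next
    fix a assume "a \<in> Fact I G h"
    then obtain y where aP: "a \<in> carrier (pair_product I G)"
      and y: "y \<in> (\<Pi>\<^sub>E i \<in> Field I. carrier (G i))"
      and a: "\<And>i j. (i, j) \<in> I - Id \<Longrightarrow> a (i, j) = y i \<otimes>\<^bsub>G i\<^esub> inv\<^bsub>G i\<^esub> (h i j (y j))"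
      unfolding Fact_def by blast
    let ?z = "\<lambda>i\<in>Field I. inv\<^bsub>G i\<^esub> (y i)"
    have "(inv\<^bsub>pair_product I G\<^esub> a) (i, j) = ?z i \<otimes>\<^bsub>G i\<^esub> inv\<^bsub>G i\<^esub> (h i j (?z j))"
      if ij: "(i, j) \<in> I - Id" for i j
    proof -
      interpret H: group_hom "G j" "G i" "h i j" by (rule group_hom) fact
      interpret C: comm_group "G i" using comm_group lt_Field[OF ij] by blast
      have m: "y i \<in> carrier (G i)" "y j \<in> carrier (G j)" using y lt_Field[OF ij] by auto
      then show ?thesis using lt_Field[OF ij]
        by (simp only: inv_pair_product[OF aP ij] a[OF ij]) (simp add: C.inv_mult)
    qed
    moreover have "?z \<in> (\<Pi>\<^sub>E i \<in> Field I. carrier (G i))"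
      using group y by (auto intro!: group.inv_closed)
    ultimately show "inv\<^bsub>pair_product I G\<^esub> a \<in> Fact I G h"
      using P.inv_closed[OF aP] unfolding Fact_def by blast
  next
    fix a b assume "a \<in> Fact I G h" "b \<in> Fact I G h"
    then obtain y z where aP: "a \<in> carrier (pair_product I G)"
      and bP: "b \<in> carrier (pair_product I G)"
      and y: "y \<in> (\<Pi>\<^sub>E i \<in> Field I. carrier (G i))" and z: "z \<in> (\<Pi>\<^sub>E i \<in> Field I. carrier (G i))"
      and a: "\<And>i j. (i, j) \<in> I - Id \<Longrightarrow> a (i, j) = y i \<otimes>\<^bsub>G i\<^esub> inv\<^bsub>G i\<^esub> (h i j (y j))"
      and b: "\<And>i j. (i, j) \<in> I - Id \<Longrightarrow> b (i, j) = z i \<otimes>\<^bsub>G i\<^esub> inv\<^bsub>G i\<^esub> (h i j (z j))"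
      unfolding Fact_def by blast
    let ?z = "\<lambda>i\<in>Field I. y i \<otimes>\<^bsub>G i\<^esub> z i"
    have "(a \<otimes>\<^bsub>pair_product I G\<^esub> b) (i, j) = ?z i \<otimes>\<^bsub>G i\<^esub> inv\<^bsub>G i\<^esub> (h i j (?z j))"
      if ij: "(i, j) \<in> I - Id" for i j
    proof -
      interpret H: group_hom "G j" "G i" "h i j" by (rule group_hom) fact
      interpret C: comm_group "G i" using comm_group lt_Field[OF ij] by blast
      have m: "y i \<in> carrier (G i)" "y j \<in> carrier (G j)" "z i \<in> carrier (G i)" "z j \<in> carrier (G j)"
        using y z lt_Field[OF ij] by auto
      then show ?thesis using lt_Field[OF ij]
        by (simp only: mult_pair_product[OF ij] a[OF ij] b[OF ij]) (simp add: C.inv_mult C.m_ac)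
    qed
    moreover have "?z \<in> (\<Pi>\<^sub>E i \<in> Field I. carrier (G i))"
      using group y z by (auto intro!: monoid.m_closed group.is_monoid)
    ultimately show "a \<otimes>\<^bsub>pair_product I G\<^esub> b \<in> Fact I G h"
      using P.m_closed[OF aP bP] unfolding Fact_def by blast
  qed
qed

lemma comm_group_quotient_limit: "comm_group (quotient_limit I G h)"
proof -
  interpret P: comm_group "pair_product I G" by (rule comm_group_pair_product)
  have "comm_group ((pair_product I G)\<lparr>carrier := Gr I G h\<rparr>)"
  proof (rule group.group_comm_groupI[OF P.subgroup_imp_group[OF subgroup_Gr]])
    show "x \<otimes>\<^bsub>(pair_product I G)\<lparr>carrier := Gr I G h\<rparr>\<^esub> y
        = y \<otimes>\<^bsub>(pair_product I G)\<lparr>carrier := Gr I G h\<rparr>\<^esub> x"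
      if "x \<in> carrier ((pair_product I G)\<lparr>carrier := Gr I G h\<rparr>)"
         "y \<in> carrier ((pair_product I G)\<lparr>carrier := Gr I G h\<rparr>)" for x y
      using that P.m_comm by (auto simp: Gr_def)
  qed
  moreover have "subgroup (Fact I G h) ((pair_product I G)\<lparr>carrier := Gr I G h\<rparr>)"
    using P.subgroup_incl[OF subgroup_Fact subgroup_Gr Fact_subset_Gr] .
  ultimately show ?thesis
    unfolding quotient_limit_def by (rule comm_group.abelian_FactGroup)
qed

end

end

theory Submission
  imports Defs "HOL-Library.Poly_Mapping" "HOL-Library.Function_Algebras"
begin

text \<open>
  The quotient limit is a first derived inverse limit: \<open>Gr\<close> consists of the 1-cocycles of the inverse
  system and \<open>Fact\<close> of its coboundaries. Derived limits can be read off from short exact sequences,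
  and the proof uses one sequence only. Given a \<open>\<kappa>\<close>-system of abelian groups \<open>K\<^sub>i\<close>, let \<open>B\<^sub>i\<close> be the
  group of finitely supported functions from \<open>[i, \<kappa>)\<close> to \<open>K\<^sub>i\<close>, and let \<open>A\<^sub>i\<close> be the kernel of the
  summation map \<open>B\<^sub>i \<rightarrow> K\<^sub>i\<close>. The inverse limit of the \<open>B\<^sub>i\<close> is trivial, and so is their derived limit:
  a cocycle \<open>a\<^sub>i\<^sub>j\<close> stabilises pointwise as \<open>j\<close> grows, to a function \<open>F\<^sub>i\<close> which has finite support on each
  proper initial segment, hence finite support altogether since no countable set is unbounded in \<open>\<kappa>\<close>,
  and \<open>a\<close> is the coboundary of \<open>F\<close>. Hence the derived limit of \<open>A\<close> is the ordinary inverse limit of \<open>K\<close>,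
  while \<open>A\<^sub>i\<close> is no larger than \<open>\<kappa>\<close> and \<open>K\<^sub>i\<close> together (\<open>quotient_limit_realises_limit\<close>). The problem has
  become that of finding systems of small groups whose ordinary limit has size \<open>\<mu>\<close>.

  If \<open>\<mu>\<close> is finite, the constant system of the integers modulo \<open>\<mu>\<close> serves. If \<open>\<mu>\<close> is infinite, take a
  tree of height \<open>\<kappa>\<close> with levels of size below \<open>\<lambda>\<close> and let \<open>K\<^sub>i\<close> be the free abelian group on level \<open>i\<close>.
  In a coherent sequence of elements the supports grow in size, so by uncountable cofinality their sizes
  are eventually constant and the sequence is a finite combination of branches. The limit
  therefore has the size of the set of branches (\<open>quotient_limit_counts_branches\<close>), and it remains to
  find trees with exactly \<open>\<mu>\<close> branches. For \<open>\<mu> \<le> \<lambda>\<close> such a tree comes directly from a filtration of a set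
  of size \<open>\<mu>\<close> into \<open>\<kappa>\<close> pieces of size below \<open>\<lambda>\<close> (\<open>filtration_tree\<close>).

  For \<open>\<lambda> < \<mu> \<le> \<lambda>\<^sup>\<kappa>\<close> the approximations to functions from \<open>\<kappa>\<close> to \<open>\<lambda>\<close> form a tree with at least \<open>\<mu>\<close>
  branches (\<open>function_tree\<close>); its levels are small because \<open>\<theta>\<^bsup><\<kappa>\<^esup> < \<lambda>\<close>. A tree with exactly \<open>\<mu>\<close> branches is
  then cut out by an argument in the style of Galvin and Hajnal
  (\<open>subtree_with_prescribed_branches\<close>). Among the functions that bound the level sizes of a family of
  at least \<open>\<mu>\<close> branches one chooses a minimal one, modulo bounded sets and finite partitions of \<open>\<kappa>\<close>;
  uncountable cofinality makes this order well-founded. Index sets on which the bound could be improved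
  form an ideal. In a family with minimal bound, closed in the sense that it consists of all branches
  of a subtree, say that a branch \<open>f\<close> lies
  below \<open>g\<close> if the set of levels where \<open>f\<close> comes before \<open>g\<close> is not in the ideal. Of two distinct branches
  one is below the other, whereas by minimality the branches below \<open>g\<close> split into at most \<open>2\<^sup>\<kappa> \<le> \<mu>\<close> pieces
  with closures of size at most \<open>\<mu>\<close>. So either the family has exactly \<open>\<mu>\<close> members, or some \<open>g\<close> has at
  least \<open>\<mu>\<close> branches below it, and then the disjoint union of the subtrees spanned by the pieces has
  exactly \<open>\<mu>\<close> branches.
\<close>

section \<open>Cardinal arithmetic\<close>

lemma Card_order_le_cases:
  "Card_order r \<Longrightarrow> Card_order s \<Longrightarrow> \<not> r \<le>o s \<Longrightarrow> s <o r"
  using not_ordLeq_iff_ordLess by (auto simp: card_order_on_def)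

lemma card_of_le_cases: "\<not> |A| \<le>o |B| \<Longrightarrow> |B| <o |A|"
  by (rule Card_order_le_cases) (auto simp: card_of_Card_order)

lemma Cinfinite_card_of: "infinite A \<Longrightarrow> Cinfinite |A|"
  using card_of_Card_order[of A] by (simp add: cinfinite_def Field_card_of)

lemma countable_ordLeq_infinite:
  assumes "countable A" and "Cinfinite r"
  shows "|A| \<le>o r"
proof -
  have "|A| \<le>o natLeq"
    using assms(1) card_of_nat ordLeq_ordIso_trans
    by (metis (full_types) UNIV_I card_of_ordLeqI countable_def)
  then show ?thesis
    using assms(2) natLeq_ordLeq_cinfinite ordLeq_transitive by blast
qed

lemma card_of_Fpow_ordLeq:
  assumes "|A| \<le>o r" and r: "Cinfinite r"
  shows "|Fpow A| \<le>o r"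
proof -
  have L: "|{xs. set xs \<subseteq> A \<and> length xs = n}| \<le>o r" for n
  proof (induction n)
    case 0
    have "{xs. set xs \<subseteq> A \<and> length xs = 0} = {[]}" by auto
    then show ?case using countable_ordLeq_infinite[of "{[]}" r] r by (simp only:) simp
  next
    case (Suc n)
    have "{xs. set xs \<subseteq> A \<and> length xs = Suc n}
        \<subseteq> (\<lambda>(x, xs). x # xs) ` (A \<times> {xs. set xs \<subseteq> A \<and> length xs = n})"
      by (auto simp: length_Suc_conv image_iff)
    then have "|{xs. set xs \<subseteq> A \<and> length xs = Suc n}| \<le>o |A \<times> {xs. set xs \<subseteq> A \<and> length xs = n}|"
      by (rule surj_imp_ordLeq)
    also have "|A \<times> {xs. set xs \<subseteq> A \<and> length xs = n}| \<le>o r"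
      using card_of_Times_ordLeq_infinite_Field[of r] r assms(1) Suc by (simp add: cinfinite_def)
    finally show ?case .
  qed
  have "Fpow A \<subseteq> set ` (\<Union>n. {xs. set xs \<subseteq> A \<and> length xs = n})"
  proof
    fix X assume "X \<in> Fpow A"
    then obtain xs where "set xs = X" "X \<subseteq> A" using finite_list by (auto simp: Fpow_def)
    then show "X \<in> set ` (\<Union>n. {xs. set xs \<subseteq> A \<and> length xs = n})" by blast
  qed
  then have "|Fpow A| \<le>o |\<Union>n. {xs. set xs \<subseteq> A \<and> length xs = n}|"
    by (rule surj_imp_ordLeq)
  also have "|\<Union>n. {xs. set xs \<subseteq> A \<and> length xs = n}| \<le>o r"
    using L r by (intro UNION_Cinfinite_bound countable_ordLeq_infinite) auto
  finally show ?thesis .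
qed

lemma card_of_Fpow_ordLess:
  assumes A: "|A| <o r" and r: "natLeq <o r" "Card_order r"
  shows "|Fpow A| <o r"
proof (cases "finite A")
  case True
  have inf: "cinfinite r"
    using r cinfinite_mono[OF ordLess_imp_ordLeq natLeq_cinfinite] by blast
  have "finite (Fpow A)" using True by (simp add: Fpow_Pow_finite)
  then show ?thesis
    using inf r(2) Cfinite_ordLess_Cinfinite[of "|Fpow A|" r]
    by (simp add: cfinite_def card_of_card_order_on Field_card_of)
next
  case False
  then have "|Fpow A| \<le>o |A|"
    by (intro card_of_Fpow_ordLeq Cinfinite_card_of) (auto simp: card_of_refl ordIso_imp_ordLeq)
  then show ?thesis using A by (rule ordLeq_ordLess_trans)
qed

text \<open>
  A function is determined by the part of its graph over its support.
\<close>

lemma card_of_finitely_supported: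
  fixes K :: "'b::zero set" and S :: "'k set"
  shows "|{f. finite {s. f s \<noteq> 0} \<and> {s. f s \<noteq> 0} \<subseteq> S \<and> range f \<subseteq> K}| \<le>o |Fpow (S \<times> K)|"
proof (rule card_of_ordLeqI)
  show "inj_on (\<lambda>f. {(s, f s) | s. f s \<noteq> 0}) {f. finite {s. f s \<noteq> 0} \<and> {s. f s \<noteq> 0} \<subseteq> S \<and> range f \<subseteq> K}"
  proof (rule inj_onI, rule ext)
    fix f g s
    assume "{(s, f s) | s. f s \<noteq> (0::'b)} = {(s, g s) | s. g s \<noteq> 0}"
    then have "(s, t) \<in> {(s, f s) | s. f s \<noteq> 0} \<longleftrightarrow> (s, t) \<in> {(s, g s) | s. g s \<noteq> 0}" for t
      by simp
    from this[of "f s"] this[of "g s"] show "f s = g s"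
      by (cases "f s = 0"; cases "g s = 0") auto
  qed
next
  fix f :: "'k \<Rightarrow> 'b"
  assume f: "f \<in> {f. finite {s. f s \<noteq> 0} \<and> {s. f s \<noteq> 0} \<subseteq> S \<and> range f \<subseteq> K}"
  have "{(s, f s) | s. f s \<noteq> 0} = (\<lambda>s. (s, f s)) ` {s. f s \<noteq> 0}" by auto
  with f show "{(s, f s) | s. f s \<noteq> 0} \<in> Fpow (S \<times> K)"
    by (auto simp: Fpow_def)
qed

lemma card_of_frag:
  shows "|{c :: 'v \<Rightarrow>\<^sub>0 int. Poly_Mapping.keys c \<subseteq> S}| \<le>o |Fpow (S \<times> (UNIV :: int set))|"
proof -
  have "|{c :: 'v \<Rightarrow>\<^sub>0 int. Poly_Mapping.keys c \<subseteq> S}|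
     \<le>o |{f :: 'v \<Rightarrow> int. finite {s. f s \<noteq> 0} \<and> {s. f s \<noteq> 0} \<subseteq> S \<and> range f \<subseteq> UNIV}|"
  proof (rule card_of_ordLeqI)
    show "inj_on Poly_Mapping.lookup {c :: 'v \<Rightarrow>\<^sub>0 int. Poly_Mapping.keys c \<subseteq> S}"
      by (rule inj_onI) (simp add: poly_mapping_eqI)
    show "Poly_Mapping.lookup c \<in> {f :: 'v \<Rightarrow> int. finite {s. f s \<noteq> 0} \<and> {s. f s \<noteq> 0} \<subseteq> S \<and> range f \<subseteq> UNIV}"
      if "c \<in> {c :: 'v \<Rightarrow>\<^sub>0 int. Poly_Mapping.keys c \<subseteq> S}" for c
      using that by (auto simp: in_keys_iff subset_iff)
  qed
  also note card_of_finitely_supported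
  finally show ?thesis .
qed

lemma card_of_Times_ordLess:
  assumes "|A| <o r" "|B| <o r" "Cinfinite r"
  shows "|A \<times> B| <o r"
proof (cases "finite A \<and> finite B")
  case True
  then show ?thesis
    using Cfinite_ordLess_Cinfinite[of "|A \<times> B|" r] assms(3)
    by (simp add: cfinite_def card_of_card_order_on Field_card_of)
next
  case False
  then have inf: "infinite (A <+> B)" by simp
  have "|A <+> B| <o r"
    using assms card_of_Plus_ordLess_infinite_Field by (auto simp: cinfinite_def)
  moreover have "|A \<times> B| \<le>o |A <+> B|"
    using inf card_of_Times_ordLeq_infinite_Field[OF _ card_of_Plus1 card_of_Plus2 card_of_Card_order]
    by (simp add: Field_card_of)
  ultimately show ?thesis using ordLeq_ordLess_trans by blast
qed

section \<open>Orders of uncountable cofinality\<close>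

text \<open>
  Strict bounds for countable subsets are the only trace of the cofinality of \<open>\<kappa>\<close> in what follows. The
  empty set and singletons are countable, so the order is nonempty without a last element.
\<close>

locale uncountable_cofinality =
  fixes I :: "'k rel"
  assumes Well_order: "Well_order I"
    and countable_bounded: "\<And>C. C \<subseteq> Field I \<Longrightarrow> countable C \<Longrightarrow> \<exists>j\<in>Field I. \<forall>c\<in>C. (c, j) \<in> I - Id"
begin

definition lt :: "'k \<Rightarrow> 'k \<Rightarrow> bool" (infix "\<triangleleft>" 50) where "i \<triangleleft> j \<longleftrightarrow> (i, j) \<in> I - Id"

lemma ltD: "i \<triangleleft> j \<Longrightarrow> i \<in> Field I" "i \<triangleleft> j \<Longrightarrow> j \<in> Field I"
  by (auto simp: lt_def Field_def)

lemma lt_trans: "i \<triangleleft> j \<Longrightarrow> j \<triangleleft> k \<Longrightarrow> i \<triangleleft> k"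
  using Well_order unfolding lt_def well_order_on_def linear_order_on_def partial_order_on_def
    preorder_on_def trans_def antisym_def by blast

lemma lt_irrefl: "\<not> i \<triangleleft> i" by (simp add: lt_def)

lemma lt_asym: "i \<triangleleft> j \<Longrightarrow> \<not> j \<triangleleft> i" using lt_trans lt_irrefl by blast

lemma lt_linear: "i \<in> Field I \<Longrightarrow> j \<in> Field I \<Longrightarrow> i \<triangleleft> j \<or> i = j \<or> j \<triangleleft> i"
  using Well_order unfolding lt_def well_order_on_def linear_order_on_def total_on_def by blast

lemma above_countable: "C \<subseteq> Field I \<Longrightarrow> countable C \<Longrightarrow> \<exists>j\<in>Field I. \<forall>c\<in>C. c \<triangleleft> j"
  using countable_bounded by (simp add: lt_def)

lemma above2: "i \<in> Field I \<Longrightarrow> j \<in> Field I \<Longrightarrow> \<exists>k. i \<triangleleft> k \<and> j \<triangleleft> k"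
  using above_countable[of "{i, j}"] by auto

lemma above3: "i \<in> Field I \<Longrightarrow> j \<in> Field I \<Longrightarrow> k \<in> Field I \<Longrightarrow> \<exists>l. i \<triangleleft> l \<and> j \<triangleleft> l \<and> k \<triangleleft> l"
  using above_countable[of "{i, j, k}"] by auto

lemma nonempty: "Field I \<noteq> {}" using above_countable[of "{}"] by auto

end

text \<open>
  Enumerate a cofinal set of least size along \<open>\<kappa>\<close> and let \<open>L i\<close> collect what lies below its first \<open>i\<close>
  members. These are too few to be cofinal, so \<open>L i\<close> has an upper bound, hence small size. A
  countable unbounded subset of \<open>\<kappa>\<close> would pick out countably many such bounds, cofinal in \<open>\<lambda>\<close> and fewer
  than \<open>\<kappa>\<close>.
\<close>

lemma cofinality_filtration:
  assumes lam: "Card_order lam" and kap: "Card_order kap" and cf: "cf lam =o kap"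
    and singular: "kap <o lam" and uncountable: "natLeq <o kap"
  shows "uncountable_cofinality kap"
    and "\<exists>L. (\<forall>i\<in>Field kap. L i \<subseteq> Field lam \<and> |L i| <o lam) \<and>
              (\<forall>i j. (i, j) \<in> kap \<longrightarrow> L i \<subseteq> L j) \<and> (\<Union>i\<in>Field kap. L i) = Field lam"
proof -
  have cinf: "cinfinite kap"
    using uncountable cinfinite_mono[OF ordLess_imp_ordLeq natLeq_cinfinite] by blast
  then have infk: "infinite (Field kap)" by (simp add: cinfinite_def)
  have cinfl: "cinfinite lam" using cinf singular cinfinite_mono[OF ordLess_imp_ordLeq] by blast
  then have infl: "infinite (Field lam)" by (simp add: cinfinite_def)
  obtain A where A: "A \<subseteq> Field lam" "cofinal A lam" "cf lam = |A|"
    and minA: "\<And>B. B \<subseteq> Field lam \<Longrightarrow> cofinal B lam \<Longrightarrow> |A| \<le>o |B|"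
    using cf_cofinal[OF lam infl] by blast
  have "|Field kap| =o |A|"
    using cf A(3) card_of_Field_ordIso[OF kap] ordIso_symmetric ordIso_transitive by metis
  then obtain e where e: "bij_betw e (Field kap) A" using card_of_ordIso by blast
  have wol: "Well_order lam" and wok: "Well_order kap" using lam kap by (auto simp: card_order_on_def)
  have refl: "(x, x) \<in> kap" if "x \<in> Field kap" for x
    using wok that unfolding order_on_defs refl_on_def by blast
  have kap_lin: "i = j \<or> (i, j) \<in> kap \<or> (j, i) \<in> kap" if "i \<in> Field kap" "j \<in> Field kap" for i j
    using wok that unfolding order_on_defs total_on_def by blast
  have lam_lin: "i = j \<or> (i, j) \<in> lam \<or> (j, i) \<in> lam" if "i \<in> Field lam" "j \<in> Field lam" for i j
    using wol that unfolding order_on_defs total_on_def by blast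
  have lam_tr: "(i, k) \<in> lam" if "(i, j) \<in> lam" "(j, k) \<in> lam" for i j k
    using wol that unfolding order_on_defs trans_def by blast
  have lam_refl: "(x, x) \<in> lam" if "x \<in> Field lam" for x
    using wol that unfolding order_on_defs refl_on_def by blast
  have lam_as: "i = j" if "(i, j) \<in> lam" "(j, i) \<in> lam" for i j
    using wol that unfolding order_on_defs antisym_def by blast
  define L where "L i = {x \<in> Field lam. \<exists>j. (j, i) \<in> kap \<and> (x, e j) \<in> lam}" for i
  have eF: "e j \<in> Field lam" if "j \<in> Field kap" for j using e A(1) that by (auto simp: bij_betw_def)
  have bound: "\<exists>b\<in>Field lam. L i \<subseteq> under lam b" if i: "i \<in> Field kap" for i
  proof -
    obtain i' where i': "i' \<in> Field kap" "i \<noteq> i'" "(i, i') \<in> kap"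
      using infinite_Card_order_limit[OF kap infk i] by blast
    let ?E = "e ` under kap i"
    have sub: "under kap i \<subseteq> underS kap i'"
      using i' wok unfolding under_def underS_def order_on_defs trans_def antisym_def by blast
    have "|?E| \<le>o |under kap i|" by (rule card_of_image)
    also have "|under kap i| \<le>o |underS kap i'|" using sub by (rule card_of_mono1)
    also have "|underS kap i'| <o kap" by (rule card_of_underS[OF kap i'(1)])
    also have "kap =o |A|" using cf A(3) ordIso_symmetric by metis
    finally have "\<not> |A| \<le>o |?E|" using not_ordLess_ordLeq by blast
    moreover have "?E \<subseteq> Field lam" using eF by (auto simp: under_def Field_def)
    ultimately have "\<not> cofinal ?E lam" using minA by blast
    then obtain b where b: "b \<in> Field lam" "\<And>j. (j, i) \<in> kap \<Longrightarrow> b = e j \<or> (b, e j) \<notin> lam"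
      unfolding cofinal_def under_def by blast
    have "(e j, b) \<in> lam" if "(j, i) \<in> kap" for j
      using lam_lin[OF b(1) eF[of j]] b that lam_refl by (auto simp: Field_def)
    then have "L i \<subseteq> under lam b" unfolding L_def under_def using lam_tr by blast
    with b(1) show ?thesis by blast
  qed
  have cover: "\<exists>i\<in>Field kap. x \<in> L i" if x: "x \<in> Field lam" for x
  proof -
    obtain a where a: "a \<in> A" "(x, a) \<in> lam" using A(2) x unfolding cofinal_def by blast
    have "a \<in> e ` Field kap" using a(1) e by (simp add: bij_betw_def)
    then obtain i where "i \<in> Field kap" "a = e i" by blast
    then show ?thesis using x refl a(2) unfolding L_def by blast
  qed
  have mono: "L i \<subseteq> L j" if "(i, j) \<in> kap" for i j
    using that wok unfolding L_def order_on_defs trans_def by blast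
  have small: "|L i| <o lam" if i: "i \<in> Field kap" for i
  proof -
    obtain b where b: "b \<in> Field lam" "L i \<subseteq> under lam b" using bound[OF i] by blast
    obtain b' where b': "b' \<in> Field lam" "b \<noteq> b'" "(b, b') \<in> lam"
      using infinite_Card_order_limit[OF lam infl b(1)] by blast
    have "under lam b \<subseteq> underS lam b'"
      using b' lam_tr lam_as unfolding under_def underS_def by blast
    then have "|L i| \<le>o |underS lam b'|" using b(2) by (intro card_of_mono1) blast
    then show ?thesis using card_of_underS[OF lam b'(1)] ordLeq_ordLess_trans by blast
  qed
  show "\<exists>L. (\<forall>i\<in>Field kap. L i \<subseteq> Field lam \<and> |L i| <o lam) \<and>
              (\<forall>i j. (i, j) \<in> kap \<longrightarrow> L i \<subseteq> L j) \<and> (\<Union>i\<in>Field kap. L i) = Field lam"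
    using cover mono small by (intro exI[of _ L]) (auto simp: L_def)
  show "uncountable_cofinality kap"
  proof
    show "Well_order kap" by (rule wok)
    fix C assume C: "C \<subseteq> Field kap" "countable C"
    show "\<exists>j\<in>Field kap. \<forall>c\<in>C. (c, j) \<in> kap - Id"
    proof (rule ccontr)
      assume neg: "\<not> ?thesis"
      have unb: "\<exists>c\<in>C. (i, c) \<in> kap" if "i \<in> Field kap" for i
        using neg that kap_lin[of i] C(1) refl by blast
      have "\<forall>c\<in>C. \<exists>b'. \<exists>b. b \<in> Field lam \<and> L c \<subseteq> under lam b \<and> b' \<in> Field lam \<and> b \<noteq> b' \<and> (b, b') \<in> lam"
        using bound C(1) infinite_Card_order_limit[OF lam infl] by (metis subsetD)
      then obtain b' where b': "\<forall>c\<in>C. \<exists>b. b \<in> Field lam \<and> L c \<subseteq> under lam b \<and> b' c \<in> Field lam \<and> b \<noteq> b' c \<and> (b, b' c) \<in> lam"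
        by (rule bchoice[THEN exE]) 
      have "cofinal (b' ` C) lam"
        unfolding cofinal_def
      proof
        fix x assume "x \<in> Field lam"
        then obtain i where i: "i \<in> Field kap" "x \<in> L i" using cover by blast
        then obtain c where c: "c \<in> C" "(i, c) \<in> kap" using unb by blast
        then have "x \<in> L c" using i mono by blast
        then obtain b where b: "(x, b) \<in> lam" "b \<noteq> b' c" "(b, b' c) \<in> lam"
          using b' c(1) unfolding under_def by blast
        then have "x \<noteq> b' c" "(x, b' c) \<in> lam" using lam_tr lam_as by blast+
        then show "\<exists>b\<in>b' ` C. x \<noteq> b \<and> (x, b) \<in> lam" using c(1) by blast
      qed
      then have "|A| \<le>o |b' ` C|" using b' by (intro minA) auto
      also have "|b' ` C| \<le>o natLeq"
        using C(2) by (intro countable_ordLeq_infinite natLeq_Cinfinite) auto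
      also have "natLeq <o kap" by (rule uncountable)
      also have "kap =o |A|" using cf A(3) ordIso_symmetric by metis
      finally show False using ordLess_irreflexive by blast
    qed
  qed
qed

section \<open>Inverse systems on a prescribed type\<close>

lemma card_of_image_mono_kernels:
  assumes eq: "\<And>a b. a \<in> S \<Longrightarrow> b \<in> S \<Longrightarrow> u a = u b \<Longrightarrow> v a = v b"
  shows "|v ` S| \<le>o |u ` S|"
proof (rule surj_imp_ordLeq[of _ "\<lambda>t. v (inv_into S u t)"], rule subsetI)
  fix t assume "t \<in> v ` S"
  then obtain a where a: "a \<in> S" "t = v a" by blast
  then have ua: "u a \<in> u ` S" by simp
  have "v (inv_into S u (u a)) = v a"
    using eq[OF inv_into_into[OF ua] a(1)] f_inv_into_f[OF ua] by simp
  then show "t \<in> (\<lambda>t. v (inv_into S u t)) ` u ` S" using ua a(2) by (simp add: rev_image_eqI)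
qed

lemma card_of_image_eq_kernels:
  assumes "\<And>a b. a \<in> S \<Longrightarrow> b \<in> S \<Longrightarrow> u a = u b \<longleftrightarrow> v a = v b"
  shows "|u ` S| =o |v ` S|"
  using card_of_image_mono_kernels[of S u v] card_of_image_mono_kernels[of S v u] assms
  by (simp add: ordIso_iff_ordLeq)

text \<open>
  The form in which quotient limits are computed below: any function on cocycles that identifies
  exactly the cohomologous ones counts the cosets, and it need not be a homomorphism.
\<close>

lemma (in inverse_system) card_of_quotient_limit:
  assumes "\<And>a b. a \<in> Gr I G h \<Longrightarrow> b \<in> Gr I G h \<Longrightarrow>
             f a = f b \<longleftrightarrow> a \<otimes>\<^bsub>pair_product I G\<^esub> inv\<^bsub>pair_product I G\<^esub> b \<in> Fact I G h"
  shows "|carrier (quotient_limit I G h)| =o |f ` Gr I G h|"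
proof -
  interpret P: group "pair_product I G" by (rule group_pair_product)
  define R where "R = (pair_product I G)\<lparr>carrier := Gr I G h\<rparr>"
  interpret R: group R unfolding R_def by (rule P.subgroup_imp_group[OF subgroup_Gr])
  have sub: "subgroup (Fact I G h) R"
    unfolding R_def by (rule P.subgroup_incl[OF subgroup_Fact subgroup_Gr Fact_subset_Gr])
  have carR: "carrier R = Gr I G h" by (simp add: R_def)
  have invR: "inv\<^bsub>R\<^esub> b = inv\<^bsub>pair_product I G\<^esub> b" if "b \<in> Gr I G h" for b
    unfolding R_def using P.m_inv_consistent[OF subgroup_Gr that] by simp
  have "Fact I G h #>\<^bsub>R\<^esub> a = Fact I G h #>\<^bsub>R\<^esub> b \<longleftrightarrow> f a = f b"
    if a: "a \<in> Gr I G h" and b: "b \<in> Gr I G h" for a b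
  proof -
    have "Fact I G h #>\<^bsub>R\<^esub> a = Fact I G h #>\<^bsub>R\<^esub> b \<longleftrightarrow> a \<in> Fact I G h #>\<^bsub>R\<^esub> b"
      using R.repr_independence[OF _ _ sub] R.rcos_self[OF _ sub] a b carR by metis
    also have "\<dots> \<longleftrightarrow> a \<otimes>\<^bsub>R\<^esub> inv\<^bsub>R\<^esub> b \<in> Fact I G h"
      using subgroup.rcos_module[OF sub R.is_group, of b a] a b carR by blast
    also have "\<dots> \<longleftrightarrow> f a = f b"
      using assms[OF a b] invR[OF b] by (simp add: R_def)
    finally show ?thesis .
  qed
  moreover have "carrier (quotient_limit I G h) = (\<lambda>a. Fact I G h #>\<^bsub>R\<^esub> a) ` Gr I G h"
    unfolding quotient_limit_def R_def[symmetric] by (auto simp: FactGroup_def RCOSETS_def carR)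
  ultimately show ?thesis
    using card_of_image_eq_kernels[of "Gr I G h" "\<lambda>a. Fact I G h #>\<^bsub>R\<^esub> a" f] by simp
qed

context uncountable_cofinality
begin

definition cocycles :: "('k \<Rightarrow> 'd::ab_group_add set) \<Rightarrow> ('k \<Rightarrow> 'd \<Rightarrow> 'd) \<Rightarrow> ('k \<Rightarrow> 'k \<Rightarrow> 'd) set" where
  "cocycles A P = {a. (\<forall>i j. i \<triangleleft> j \<longrightarrow> a i j \<in> A i) \<and>
     (\<forall>i j k. i \<triangleleft> j \<longrightarrow> j \<triangleleft> k \<longrightarrow> a i k = a i j + P i (a j k))}"

definition cohomologous where
  "cohomologous A P a b \<longleftrightarrow> (\<exists>y. (\<forall>i\<in>Field I. y i \<in> A i) \<and>
     (\<forall>i j. i \<triangleleft> j \<longrightarrow> a i j - b i j = y i - P i (y j)))"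

text \<open>
  Calculations are convenient for subgroups \<open>A i\<close> of one type class group, whereas the sought
  groups are records on the type of \<open>\<lambda>\<close>. Here the former are carried over to the latter along arbitrary
  injections \<open>e i\<close>, so that only cocycles in the type class remain to be studied.
\<close>

lemma realise_in_type:
  fixes A :: "'k \<Rightarrow> 'd::ab_group_add set" and X :: "'x set"
  assumes zero: "\<And>i. i \<in> Field I \<Longrightarrow> 0 \<in> A i"
    and minus: "\<And>i x y. i \<in> Field I \<Longrightarrow> x \<in> A i \<Longrightarrow> y \<in> A i \<Longrightarrow> x - y \<in> A i"
    and P_add: "\<And>i j x y. i \<triangleleft> j \<Longrightarrow> x \<in> A j \<Longrightarrow> y \<in> A j \<Longrightarrow> P i (x + y) = P i x + P i y"
    and P_in: "\<And>i j x. i \<triangleleft> j \<Longrightarrow> x \<in> A j \<Longrightarrow> P i x \<in> A i"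
    and P_P: "\<And>i j k x. i \<triangleleft> j \<Longrightarrow> j \<triangleleft> k \<Longrightarrow> x \<in> A k \<Longrightarrow> P i (P j x) = P i x"
    and emb: "\<And>i. i \<in> Field I \<Longrightarrow> |A i| \<le>o |UNIV :: 'a set|"
    and \<Phi>: "\<Phi> ` cocycles A P = X"
    and ker: "\<And>a b. a \<in> cocycles A P \<Longrightarrow> b \<in> cocycles A P \<Longrightarrow> \<Phi> a = \<Phi> b \<longleftrightarrow> cohomologous A P a b"
  shows "\<exists>(G :: 'k \<Rightarrow> 'a monoid) h. inverse_system I G h \<and>
           (\<forall>i\<in>Field I. |carrier (G i)| =o |A i| ) \<and> |carrier (quotient_limit I G h)| =o |X|"
proof -
  have "\<exists>e :: 'd \<Rightarrow> 'a. inj_on e (A i)" if "i \<in> Field I" for i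
    using emb[OF that, unfolded card_of_ordLeq[symmetric]] by blast
  then obtain e :: "'k \<Rightarrow> 'd \<Rightarrow> 'a" where e: "\<And>i. i \<in> Field I \<Longrightarrow> inj_on (e i) (A i)"
    by metis
  define d where "d i = inv_into (A i) (e i)" for i
  have de: "d i (e i x) = x" if "i \<in> Field I" "x \<in> A i" for i x
    using e[OF that(1)] that by (simp add: d_def)
  have neg: "- x \<in> A i" if "i \<in> Field I" "x \<in> A i" for i x
    using minus[OF that(1) zero[OF that(1)] that(2)] by simp
  have add: "x + y \<in> A i" if "i \<in> Field I" "x \<in> A i" "y \<in> A i" for i x y
    using minus[OF that(1) that(2) neg[OF that(1,3)]] by simp
  define G where "G i = \<lparr>carrier = e i ` A i, mult = \<lambda>x y. e i (d i x + d i y), one = e i 0\<rparr>" for i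
  define h where "h i j x = e i (P i (d j x))" for i j x
  have car: "carrier (G i) = e i ` A i" for i by (simp add: G_def)
  have mul: "e i x \<otimes>\<^bsub>G i\<^esub> e i y = e i (x + y)" if "i \<in> Field I" "x \<in> A i" "y \<in> A i" for i x y
    using that by (simp add: G_def de)
  have one: "\<one>\<^bsub>G i\<^esub> = e i 0" for i by (simp add: G_def)
  have cg: "comm_group (G i)" if i: "i \<in> Field I" for i
  proof (rule comm_groupI)
    show "x \<otimes>\<^bsub>G i\<^esub> y \<in> carrier (G i)" if "x \<in> carrier (G i)" "y \<in> carrier (G i)" for x y
      using that i by (auto simp: car mul intro!: imageI add)
    show "\<one>\<^bsub>G i\<^esub> \<in> carrier (G i)" using zero[OF i] by (simp add: car one)
    show "x \<otimes>\<^bsub>G i\<^esub> y \<otimes>\<^bsub>G i\<^esub> z = x \<otimes>\<^bsub>G i\<^esub> (y \<otimes>\<^bsub>G i\<^esub> z)"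
      if "x \<in> carrier (G i)" "y \<in> carrier (G i)" "z \<in> carrier (G i)" for x y z
      using that i by (auto simp: car mul add add.assoc)
    show "x \<otimes>\<^bsub>G i\<^esub> y = y \<otimes>\<^bsub>G i\<^esub> x" if "x \<in> carrier (G i)" "y \<in> carrier (G i)" for x y
      using that i by (auto simp: car mul add.commute)
    show "\<one>\<^bsub>G i\<^esub> \<otimes>\<^bsub>G i\<^esub> x = x" if "x \<in> carrier (G i)" for x
      using that i zero[OF i] by (auto simp: car mul one)
    show "\<exists>y\<in>carrier (G i). y \<otimes>\<^bsub>G i\<^esub> x = \<one>\<^bsub>G i\<^esub>" if "x \<in> carrier (G i)" for x
    proof -
      from that obtain u where u: "u \<in> A i" "x = e i u" by (auto simp: car)
      then have "e i (- u) \<otimes>\<^bsub>G i\<^esub> x = \<one>\<^bsub>G i\<^esub>" using i neg by (simp add: mul one)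
      then show ?thesis using u neg[OF i] by (auto simp: car)
    qed
  qed
  have inv: "inv\<^bsub>G i\<^esub> (e i x) = e i (- x)" if i: "i \<in> Field I" and x: "x \<in> A i" for i x
  proof -
    interpret group "G i" using cg[OF i] by (simp add: comm_group_def)
    show ?thesis
      by (rule inv_equality) (use i x neg in \<open>auto simp: mul one car\<close>)
  qed
  have hh: "h i j (e j x) = e i (P i x)" if "i \<triangleleft> j" "x \<in> A j" for i j x
    using that ltD[OF that(1)] by (simp add: h_def de)
  interpret S: inverse_system I G h
  proof (rule inverse_system.intro)
    show "Well_order I" "Field I \<noteq> {}" by (fact Well_order nonempty)+
    show "\<exists>j. (i, j) \<in> I - Id" if "i \<in> Field I" for i
      using above2[OF that that] by (auto simp: lt_def)
    show "comm_group (G i)" if "i \<in> Field I" for i using that by (rule cg)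
    show "h i j \<in> hom (G j) (G i)" if "(i, j) \<in> I - Id" for i j
    proof -
      have ij: "i \<triangleleft> j" using that by (simp add: lt_def)
      note F = ltD[OF ij]
      show ?thesis
        by (rule homI) (use F P_in[OF ij] in \<open>auto simp: car mul hh[OF ij] add P_add[OF ij]\<close>)
    qed
    show "h i j (h j k x) = h i k x"
      if "(i, j) \<in> I - Id" "(j, k) \<in> I - Id" and x: "x \<in> carrier (G k)" for i j k x
    proof -
      have ij: "i \<triangleleft> j" and jk: "j \<triangleleft> k" using that by (simp_all add: lt_def)
      obtain u where u: "u \<in> A k" "x = e k u" using x by (auto simp: car)
      then show ?thesis
        using ij jk lt_trans[OF ij jk] P_in[OF jk] P_P[OF ij jk] by (simp add: hh)
    qed
  qed
  define dec where "dec a i j = d i (a (i, j))" for a :: "'k \<times> 'k \<Rightarrow> 'a" and i j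
  have car_dec: "dec a i j \<in> A i" "a (i, j) = e i (dec a i j)"
    if a: "a \<in> carrier (pair_product I G)" and ij: "i \<triangleleft> j" for a i j
  proof -
    have "a (i, j) \<in> e i ` A i"
      using S.pair_productD[OF a] ij by (simp add: lt_def car)
    then show "dec a i j \<in> A i" "a (i, j) = e i (dec a i j)"
      using ltD[OF ij] by (auto simp: dec_def de)
  qed
  have eq_iff: "e i x = e i y \<longleftrightarrow> x = y" if "i \<in> Field I" "x \<in> A i" "y \<in> A i" for i x y
    using e[OF that(1)] that(2,3) by (rule inj_on_eq_iff)
  have Gr_iff: "a \<in> Gr I G h \<longleftrightarrow> a \<in> carrier (pair_product I G) \<and> dec a \<in> cocycles A P" for a
  proof -
    have eq: "a (i, k) = a (i, j) \<otimes>\<^bsub>G i\<^esub> h i j (a (j, k)) \<longleftrightarrow> dec a i k = dec a i j + P i (dec a j k)"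
      if a: "a \<in> carrier (pair_product I G)" and ij: "i \<triangleleft> j" and jk: "j \<triangleleft> k" for i j k
      using car_dec[OF a ij] car_dec[OF a jk] car_dec[OF a lt_trans[OF ij jk]] ltD[OF ij] P_in[OF ij]
      by (simp add: hh[OF ij] mul eq_iff add)
    show ?thesis
    proof (cases "a \<in> carrier (pair_product I G)")
      case True
      show ?thesis
        unfolding Gr_def cocycles_def mem_Collect_eq lt_def[symmetric]
        using True car_dec(1)[OF True] eq[OF True] by meson
    qed (simp add: Gr_def)
  qed
  have PiE_in: "(\<lambda>p\<in>I - Id. e (fst p) (z (fst p) (snd p))) \<in> carrier (pair_product I G)"
    if z: "\<And>i j. i \<triangleleft> j \<Longrightarrow> z i j \<in> A i" for z
    unfolding pair_product_def by (auto simp: PiE_iff car lt_def intro!: imageI z)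
  have cob: "a \<otimes>\<^bsub>pair_product I G\<^esub> inv\<^bsub>pair_product I G\<^esub> b \<in> Fact I G h \<longleftrightarrow> cohomologous A P (dec a) (dec b)"
    if a: "a \<in> carrier (pair_product I G)" and b: "b \<in> carrier (pair_product I G)" for a b
  proof -
    interpret PP: group "pair_product I G" by (rule S.group_pair_product)
    let ?c = "a \<otimes>\<^bsub>pair_product I G\<^esub> inv\<^bsub>pair_product I G\<^esub> b"
    have c: "?c \<in> carrier (pair_product I G)" using a b by simp
    have cij: "?c (i, j) = e i (dec a i j - dec b i j)" if ij: "i \<triangleleft> j" for i j
    proof -
      have "?c (i, j) = a (i, j) \<otimes>\<^bsub>G i\<^esub> inv\<^bsub>G i\<^esub> (b (i, j))"
        using S.mult_pair_product[OF ij[unfolded lt_def]] S.inv_pair_product[OF b ij[unfolded lt_def]]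
        by simp
      also have "\<dots> = e i (dec a i j - dec b i j)"
        using car_dec[OF a ij] car_dec[OF b ij] ltD[OF ij] neg by (simp add: inv mul)
      finally show ?thesis .
    qed
    have yij: "e i u \<otimes>\<^bsub>G i\<^esub> inv\<^bsub>G i\<^esub> (h i j (e j v)) = e i (u - P i v)"
      if ij: "i \<triangleleft> j" and "u \<in> A i" "v \<in> A j" for i j u v
      using that ltD[OF ij] P_in[OF ij] neg by (simp add: hh inv mul)
    have step: "?c (i, j) = e i (y i) \<otimes>\<^bsub>G i\<^esub> inv\<^bsub>G i\<^esub> (h i j (e j (y j)))
         \<longleftrightarrow> dec a i j - dec b i j = y i - P i (y j)"
      if ij: "i \<triangleleft> j" and y: "\<forall>i\<in>Field I. y i \<in> A i" for y i j
      using ltD[OF ij] y car_dec[OF a ij] car_dec[OF b ij] P_in[OF ij] minus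
      by (simp add: cij[OF ij] yij[OF ij] eq_iff)
    show ?thesis
    proof
      assume "?c \<in> Fact I G h"
      then obtain y where y: "y \<in> (\<Pi>\<^sub>E i \<in> Field I. carrier (G i))"
        and cy: "\<And>i j. i \<triangleleft> j \<Longrightarrow> ?c (i, j) = y i \<otimes>\<^bsub>G i\<^esub> inv\<^bsub>G i\<^esub> (h i j (y j))"
        unfolding Fact_def lt_def[symmetric] by blast
      have dy: "d i (y i) \<in> A i" "y i = e i (d i (y i))" if "i \<in> Field I" for i
      proof -
        have "y i \<in> e i ` A i" using y that by (auto simp: car PiE_iff)
        then show "d i (y i) \<in> A i" "y i = e i (d i (y i))" using that by (auto simp: de)
      qed
      have "dec a i j - dec b i j = d i (y i) - P i (d j (y j))" if ij: "i \<triangleleft> j" for i j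
        using step[OF ij, of "\<lambda>i. d i (y i)"] cy[OF ij] dy ltD[OF ij] by auto
      then show "cohomologous A P (dec a) (dec b)"
        unfolding cohomologous_def using dy(1) by (intro exI[of _ "\<lambda>i. d i (y i)"]) simp
    next
      assume "cohomologous A P (dec a) (dec b)"
      then obtain y where y: "\<forall>i\<in>Field I. y i \<in> A i"
        and ab: "\<And>i j. i \<triangleleft> j \<Longrightarrow> dec a i j - dec b i j = y i - P i (y j)"
        unfolding cohomologous_def by blast
      let ?y = "\<lambda>i\<in>Field I. e i (y i)"
      have "?y \<in> (\<Pi>\<^sub>E i \<in> Field I. carrier (G i))" using y by (auto simp: car)
      moreover have "?c (i, j) = ?y i \<otimes>\<^bsub>G i\<^esub> inv\<^bsub>G i\<^esub> (h i j (?y j))" if ij: "i \<triangleleft> j" for i j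
        using step[OF ij y] ab[OF ij] ltD[OF ij] by simp
      ultimately show "?c \<in> Fact I G h"
        using c unfolding Fact_def lt_def[symmetric] by blast
    qed
  qed
  have "|carrier (quotient_limit I G h)| =o |(\<Phi> \<circ> dec) ` Gr I G h|"
    by (rule S.card_of_quotient_limit) (simp add: Gr_iff ker cob)
  moreover have "(\<Phi> \<circ> dec) ` Gr I G h = X"
  proof
    show "(\<Phi> \<circ> dec) ` Gr I G h \<subseteq> X" using \<Phi> by (auto simp: Gr_iff)
    show "X \<subseteq> (\<Phi> \<circ> dec) ` Gr I G h"
    proof
      fix x assume "x \<in> X"
      then obtain z where z: "z \<in> cocycles A P" "x = \<Phi> z" using \<Phi> by blast
      let ?a = "\<lambda>p\<in>I - Id. e (fst p) (z (fst p) (snd p))"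
      have zA: "\<And>i j. i \<triangleleft> j \<Longrightarrow> z i j \<in> A i" using z(1) by (simp add: cocycles_def)
      have a: "?a \<in> carrier (pair_product I G)" by (rule PiE_in) (rule zA)
      have eq: "dec ?a i j = z i j" if "i \<triangleleft> j" for i j
        using that zA[OF that] ltD[OF that] by (simp add: dec_def de lt_def)
      have az: "dec ?a \<in> cocycles A P"
        unfolding cocycles_def
      proof (intro CollectI conjI allI impI)
        show "dec ?a i j \<in> A i" if "i \<triangleleft> j" for i j using zA that by (simp only: eq)
        show "dec ?a i k = dec ?a i j + P i (dec ?a j k)" if "i \<triangleleft> j" "j \<triangleleft> k" for i j k
          using z(1) that lt_trans[OF that] by (simp only: eq) (auto simp: cocycles_def)
      qed
      \<comment> \<open>Encoding and decoding changes \<open>z\<close> off the pairs \<open>i < j\<close>, where cocycles are unconstrained.\<close>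
      have "P i 0 = 0" if "i \<triangleleft> j" for i j
        using P_add[OF that zero zero] ltD[OF that] by simp
      then have "cohomologous A P (dec ?a) z"
        unfolding cohomologous_def using zero by (intro exI[of _ "\<lambda>_. 0"]) (auto simp: eq)
      then have "\<Phi> (dec ?a) = x" using ker[OF az z(1)] z(2) by blast
      moreover have "?a \<in> Gr I G h" using a az by (simp only: Gr_iff)
      ultimately show "x \<in> (\<Phi> \<circ> dec) ` Gr I G h" by auto
    qed
  qed
  moreover have "|carrier (G i)| =o |A i|" if i: "i \<in> Field I" for i
    using e[OF i] unfolding car by (meson bij_betw_imageI card_of_ordIso ordIso_symmetric)
  ultimately show ?thesis using S.inverse_system_axioms by (intro exI[of _ G] exI[of _ h]) simp
qed

end

section \<open>Inverse limits as quotient limits\<close>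

text \<open>
  A countably infinite subset of \<open>S\<close> would lie below some \<open>j\<close>. This is where countable cofinality would
  break the argument.
\<close>

lemma (in uncountable_cofinality) finite_if_locally_finite:
  assumes "S \<subseteq> Field I" and fin: "\<And>j. j \<in> Field I \<Longrightarrow> finite {s \<in> S. s \<triangleleft> j}"
  shows "finite S"
proof (rule ccontr)
  assume "infinite S"
  then obtain C where C: "C \<subseteq> S" "infinite C" "countable C"
    using infinite_countable_subset'[of S] by blast
  then obtain j where j: "j \<in> Field I" "\<forall>c\<in>C. c \<triangleleft> j"
    using above_countable[of C] assms(1) by blast
  have "C \<subseteq> {s \<in> S. s \<triangleleft> j}" using C(1) j(2) by blast
  then show False using fin[OF j(1)] C(2) finite_subset by blast
qed

text \<open>
  The maps \<open>q i\<close> stand for quotient maps from \<open>K i\<close> onto groups \<open>K i / N i\<close>, where \<open>N i\<close> is the set of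
  \<open>x\<close> with \<open>q i x = q i 0\<close>; the inverse limit of interest is that of the quotients. Representing
  the quotients by functions allows the integers modulo \<open>n\<close>, for varying \<open>n\<close>, without a type for them.
\<close>

locale coefficient_system = uncountable_cofinality I for I :: "'k rel" +
  fixes K :: "'k \<Rightarrow> 'b::ab_group_add set" and p :: "'k \<Rightarrow> 'b \<Rightarrow> 'b" and q :: "'k \<Rightarrow> 'b \<Rightarrow> 'c"
  assumes K_zero: "i \<in> Field I \<Longrightarrow> 0 \<in> K i"
    and K_minus: "i \<in> Field I \<Longrightarrow> x \<in> K i \<Longrightarrow> y \<in> K i \<Longrightarrow> x - y \<in> K i"
    and p_add: "i \<triangleleft> j \<Longrightarrow> x \<in> K j \<Longrightarrow> y \<in> K j \<Longrightarrow> p i (x + y) = p i x + p i y"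
    and p_in: "i \<triangleleft> j \<Longrightarrow> x \<in> K j \<Longrightarrow> p i x \<in> K i"
    and p_p: "i \<triangleleft> j \<Longrightarrow> j \<triangleleft> k \<Longrightarrow> x \<in> K k \<Longrightarrow> p i (p j x) = p i x"
    and q_eq_iff: "i \<in> Field I \<Longrightarrow> x \<in> K i \<Longrightarrow> y \<in> K i \<Longrightarrow> q i x = q i y \<longleftrightarrow> q i (x - y) = q i 0"
    and q_p: "i \<triangleleft> j \<Longrightarrow> x \<in> K j \<Longrightarrow> q j x = q j 0 \<Longrightarrow> q i (p i x) = q i 0"
begin

text \<open>
  The inverse limit of the groups \<open>K i / N i\<close>.
\<close>

definition limit_set :: "('k \<Rightarrow> 'c) set" where
  "limit_set = {\<lambda>i\<in>Field I. q i (c i) | c.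
     (\<forall>i\<in>Field I. c i \<in> K i) \<and> (\<forall>i j. i \<triangleleft> j \<longrightarrow> q i (c i) = q i (p i (c j)))}"

text \<open>
  The groups \<open>B\<^sub>i\<close> of the short exact sequence: finitely supported functions on \<open>[i, \<kappa>)\<close>.
\<close>

definition chains :: "'k \<Rightarrow> ('k \<Rightarrow> 'b) set" where
  "chains i = {f. finite {s. f s \<noteq> 0} \<and> (\<forall>s. f s \<noteq> 0 \<longrightarrow> s \<in> Field I \<and> \<not> s \<triangleleft> i) \<and> range f \<subseteq> K i}"

text \<open>
  The groups \<open>A\<^sub>i\<close>, kernels of the summation map from \<open>chains i\<close> onto \<open>K i / N i\<close>.
\<close>

definition cycles :: "'k \<Rightarrow> ('k \<Rightarrow> 'b) set" where
  "cycles i = {f \<in> chains i. q i (Sum_any f) = q i 0}"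

definition chain_map :: "'k \<Rightarrow> ('k \<Rightarrow> 'b) \<Rightarrow> 'k \<Rightarrow> 'b" where "chain_map i f = p i \<circ> f"

lemma chain_map_apply [simp]: "chain_map i f s = p i (f s)" by (simp add: chain_map_def)

lemma K_uminus: "i \<in> Field I \<Longrightarrow> x \<in> K i \<Longrightarrow> - x \<in> K i"
  using K_minus[of i 0 x] K_zero by simp

lemma K_add: "i \<in> Field I \<Longrightarrow> x \<in> K i \<Longrightarrow> y \<in> K i \<Longrightarrow> x + y \<in> K i"
  using K_minus[of i x "- y"] K_uminus by simp

lemma p_zero: "i \<triangleleft> j \<Longrightarrow> p i 0 = 0"
  using p_add[of i j 0 0] K_zero[OF ltD(2)] by simp

lemma p_minus: "i \<triangleleft> j \<Longrightarrow> x \<in> K j \<Longrightarrow> y \<in> K j \<Longrightarrow> p i (x - y) = p i x - p i y"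
  using p_add[of i j "x - y" y] K_minus[OF ltD(2)] by (simp add: algebra_simps)

lemma chainsD:
  assumes "f \<in> chains i"
  shows "finite {s. f s \<noteq> 0}" "f s \<in> K i" "s \<triangleleft> i \<Longrightarrow> f s = 0" "s \<notin> Field I \<Longrightarrow> f s = 0"
  using assms by (auto simp: chains_def)

lemma chains_minus:
  assumes "i \<in> Field I" "f \<in> chains i" "g \<in> chains i"
  shows "f - g \<in> chains i"
proof -
  have "{s. (f - g) s \<noteq> 0} \<subseteq> {s. f s \<noteq> 0} \<union> {s. g s \<noteq> 0}" by auto
  then have "finite {s. (f - g) s \<noteq> 0}"
    using finite_subset finite_UnI[OF chainsD(1)[OF assms(2)] chainsD(1)[OF assms(3)]] by blast
  moreover have "s \<in> Field I \<and> \<not> s \<triangleleft> i" if "(f - g) s \<noteq> 0" for s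
    using that chainsD(3,4)[OF assms(2), of s] chainsD(3,4)[OF assms(3), of s]
    by (metis diff_self minus_apply)
  moreover have "(f - g) s \<in> K i" for s
    using K_minus[OF assms(1) chainsD(2)[OF assms(2)] chainsD(2)[OF assms(3)]] by simp
  ultimately show ?thesis by (auto simp: chains_def)
qed

lemma chain_map_chains:
  assumes "i \<triangleleft> j" "f \<in> chains j"
  shows "chain_map i f \<in> chains i"
proof -
  have "{s. chain_map i f s \<noteq> 0} \<subseteq> {s. f s \<noteq> 0}" using p_zero[OF assms(1)] by auto
  then have "finite {s. chain_map i f s \<noteq> 0}" using chainsD(1)[OF assms(2)] finite_subset by blast
  moreover have "s \<in> Field I \<and> \<not> s \<triangleleft> i" if "chain_map i f s \<noteq> 0" for s
  proof -
    have "f s \<noteq> 0" using that p_zero[OF assms(1)] by auto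
    then show ?thesis using assms lt_trans[OF _ assms(1)] by (auto simp: chains_def)
  qed
  ultimately show ?thesis using assms p_in[OF assms(1)] by (auto simp: chains_def)
qed

lemma chain_map_minus:
  assumes "i \<triangleleft> j" "f \<in> chains j" "g \<in> chains j"
  shows "chain_map i (f - g) = chain_map i f - chain_map i g"
  using assms p_minus[OF assms(1)] chainsD(2) by (auto simp: fun_eq_iff)

lemma chain_map_P:
  assumes "i \<triangleleft> j" "j \<triangleleft> k" "f \<in> chains k"
  shows "chain_map i (chain_map j f) = chain_map i f"
  using p_p[OF assms(1,2)] chainsD(2)[OF assms(3)] by (auto simp: fun_eq_iff)

lemma Sum_any_minus:
  assumes "f \<in> chains i" "g \<in> chains i" "i \<in> Field I"
  shows "Sum_any (f - g) = Sum_any f - Sum_any g"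
proof -
  have "Sum_any (\<lambda>s. (f - g) s + g s) = Sum_any (f - g) + Sum_any g"
    by (rule Sum_any.distrib) (use chainsD(1) assms chains_minus in blast)+
  then show ?thesis by simp
qed

lemma Sum_any_chain:
  assumes f: "f \<in> chains j" and j: "j \<in> Field I"
  shows "Sum_any f \<in> K j" and "i \<triangleleft> j \<Longrightarrow> Sum_any (chain_map i f) = p i (Sum_any f)"
proof -
  have *: "sum f S \<in> K j \<and> (i \<triangleleft> j \<longrightarrow> p i (sum f S) = (\<Sum>s\<in>S. p i (f s)))" if "finite S" for S
    using that
  proof induction
    case empty
    then show ?case using K_zero[OF j] p_zero by auto
  next
    case (insert x S)
    then show ?case using K_add[OF j] chainsD(2)[OF f] p_add by auto
  qed
  have fin: "finite {s. f s \<noteq> 0}" using chainsD(1)[OF f] .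
  show "Sum_any f \<in> K j" using *[OF fin] by (simp add: Sum_any.expand_set)
  assume ij: "i \<triangleleft> j"
  have "Sum_any (chain_map i f) = (\<Sum>s | f s \<noteq> 0. chain_map i f s)"
    by (rule Sum_any.expand_superset[OF fin]) (use p_zero[OF ij] in auto)
  then show "Sum_any (chain_map i f) = p i (Sum_any f)"
    using *[OF fin] ij by (simp add: Sum_any.expand_set)
qed

lemma cycles_chains: "f \<in> cycles i \<Longrightarrow> f \<in> chains i"
  by (simp add: cycles_def)

text \<open>
  The value is the same for all large \<open>j\<close>, since \<open>a i k - a i j\<close> is supported beyond \<open>j\<close>.
\<close>

definition lim_chain :: "('k \<Rightarrow> 'k \<Rightarrow> 'k \<Rightarrow> 'b) \<Rightarrow> 'k \<Rightarrow> 'k \<Rightarrow> 'b" where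
  "lim_chain a i s = (if s \<in> Field I then a i (SOME j. i \<triangleleft> j \<and> s \<triangleleft> j) s else 0)"

lemma cocyclesD:
  assumes "a \<in> cocycles cycles chain_map"
  shows "i \<triangleleft> j \<Longrightarrow> a i j \<in> cycles i" and "i \<triangleleft> j \<Longrightarrow> j \<triangleleft> k \<Longrightarrow> a i k = a i j + chain_map i (a j k)"
  using assms by (auto simp: cocycles_def)

lemma lim_chain_eq:
  assumes a: "a \<in> cocycles cycles chain_map" and ij: "i \<triangleleft> j" and sj: "s \<triangleleft> j"
  shows "lim_chain a i s = a i j s"
proof -
  have *: "a i j' s = a i j s" if ij: "i \<triangleleft> j" and sj: "s \<triangleleft> j" and jj: "j \<triangleleft> j'" for j j'
  proof -
    have "a j j' s = 0"
      using chainsD(3)[OF cycles_chains[OF cocyclesD(1)[OF a jj]] sj] .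
    then show ?thesis using cocyclesD(2)[OF a ij jj] p_zero[OF ij] by simp
  qed
  define j' where "j' = (SOME j. i \<triangleleft> j \<and> s \<triangleleft> j)"
  have j': "i \<triangleleft> j'" "s \<triangleleft> j'" unfolding j'_def using ij sj by (metis (mono_tags, lifting) someI)+
  have "a i j' s = a i j s"
    using lt_linear[OF ltD(2)[OF ij] ltD(2)[OF j'(1)]] *[OF ij sj] *[OF j'] by metis
  then show ?thesis using ltD(1)[OF sj] by (simp add: lim_chain_def j'_def)
qed

text \<open>
  Below any \<open>k\<close> the limit agrees with the finitely supported \<open>a i k\<close>, so its support is locally
  finite, and uncountable cofinality makes it finite.
\<close>

lemma lim_chain_chains:
  assumes a: "a \<in> cocycles cycles chain_map" and i: "i \<in> Field I"
  shows "lim_chain a i \<in> chains i"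
proof -
  have val: "\<exists>j. i \<triangleleft> j \<and> s \<triangleleft> j \<and> lim_chain a i s = a i j s" if "s \<in> Field I" for s
    using above2[OF i that] lim_chain_eq[OF a] by blast
  have ch: "a i j \<in> chains i" if "i \<triangleleft> j" for j
    using cycles_chains[OF cocyclesD(1)[OF a that]] .
  have sub: "{s. lim_chain a i s \<noteq> 0} \<subseteq> Field I" by (auto simp: lim_chain_def)
  have "finite {s. lim_chain a i s \<noteq> 0}"
  proof (rule finite_if_locally_finite[OF sub])
    fix j assume j: "j \<in> Field I"
    obtain k where k: "i \<triangleleft> k" "j \<triangleleft> k" using above2[OF i j] by blast
    have "{s \<in> {s. lim_chain a i s \<noteq> 0}. s \<triangleleft> j} \<subseteq> {s. a i k s \<noteq> 0}"
      using lim_chain_eq[OF a k(1) lt_trans[OF _ k(2)]] by auto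
    then show "finite {s \<in> {s. lim_chain a i s \<noteq> 0}. s \<triangleleft> j}"
      using chainsD(1)[OF ch[OF k(1)]] finite_subset by blast
  qed
  moreover have "lim_chain a i s \<in> K i" for s
  proof (cases "s \<in> Field I")
    case True
    then show ?thesis using val[OF True] chainsD(2)[OF ch] by metis
  next
    case False
    then show ?thesis using K_zero[OF i] by (simp add: lim_chain_def)
  qed
  moreover have "\<not> s \<triangleleft> i" if "lim_chain a i s \<noteq> 0" for s
  proof
    assume si: "s \<triangleleft> i"
    obtain j where "i \<triangleleft> j" "lim_chain a i s = a i j s" using val[OF ltD(1)[OF si]] by blast
    then show False using that chainsD(3)[OF ch _ ] si by metis
  qed
  ultimately show ?thesis using sub by (auto simp: chains_def)
qed

text \<open>
  The derived limit of the chains vanishes: pass to the limit in the cocycle identity. The limit chains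
  need not be cycles, and their sums measure how far \<open>a\<close> is from being a coboundary of cycles.
\<close>

lemma cocycle_eq_lim_chain:
  assumes a: "a \<in> cocycles cycles chain_map" and ij: "i \<triangleleft> j"
  shows "a i j = lim_chain a i - chain_map i (lim_chain a j)"
proof
  fix s
  show "a i j s = (lim_chain a i - chain_map i (lim_chain a j)) s"
  proof (cases "s \<in> Field I")
    case True
    obtain k where k: "i \<triangleleft> k" "j \<triangleleft> k" "s \<triangleleft> k" using above3 ltD[OF ij] True by blast
    have "a i k s = a i j s + p i (a j k s)" using cocyclesD(2)[OF a ij k(2)] by simp
    then show ?thesis
      using lim_chain_eq[OF a k(1,3)] lim_chain_eq[OF a k(2,3)] by (simp add: algebra_simps)
  next
    case False
    then show ?thesis
      using chainsD(4)[OF cycles_chains[OF cocyclesD(1)[OF a ij]] False] p_zero[OF ij]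
      by (simp add: lim_chain_def)
  qed
qed

definition delta :: "('k \<Rightarrow> 'b) \<Rightarrow> 'k \<Rightarrow> 'k \<Rightarrow> 'b" where
  "delta c i s = (if s = i then c i else 0)"

lemma delta_chains: "i \<in> Field I \<Longrightarrow> c i \<in> K i \<Longrightarrow> delta c i \<in> chains i"
  using K_zero lt_irrefl by (auto simp: chains_def delta_def)

lemma Sum_any_delta: "Sum_any (delta c i) = c i"
proof -
  have "Sum_any (delta c i) = sum (delta c i) {i}"
    by (rule Sum_any.expand_superset) (auto simp: delta_def)
  then show ?thesis by (simp add: delta_def)
qed

text \<open>
  Induces the inverse of the connecting map from the limit of the quotients to the derived limit of the
  cycles.
\<close>

definition invariant :: "('k \<Rightarrow> 'k \<Rightarrow> 'k \<Rightarrow> 'b) \<Rightarrow> 'k \<Rightarrow> 'c" where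
  "invariant a = (\<lambda>i\<in>Field I. q i (Sum_any (lim_chain a i)))"

text \<open>
  A coherent family \<open>c\<close> is the invariant of the coboundary of the chains with value \<open>c i\<close> at
  the point \<open>i\<close>.
\<close>

lemma invariant_image: "invariant ` cocycles cycles chain_map = limit_set"
proof
  show "invariant ` cocycles cycles chain_map \<subseteq> limit_set"
  proof
    fix x assume "x \<in> invariant ` cocycles cycles chain_map"
    then obtain a where a: "a \<in> cocycles cycles chain_map" "x = invariant a" by blast
    let ?c = "\<lambda>i. Sum_any (lim_chain a i)"
    have c: "?c i \<in> K i" if "i \<in> Field I" for i
      using Sum_any_chain(1)[OF lim_chain_chains[OF a(1) that] that] .
    have "q i (?c i) = q i (p i (?c j))" if ij: "i \<triangleleft> j" for i j
    proof -
      note F = ltD[OF ij]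
      note ch = lim_chain_chains[OF a(1) F(1)] lim_chain_chains[OF a(1) F(2)]
      have "Sum_any (a i j) = ?c i - p i (?c j)"
        using cocycle_eq_lim_chain[OF a(1) ij] Sum_any_minus[OF ch(1) chain_map_chains[OF ij ch(2)] F(1)]
          Sum_any_chain(2)[OF ch(2) F(2) ij] by simp
      moreover have "q i (Sum_any (a i j)) = q i 0"
        using cocyclesD(1)[OF a(1) ij] by (simp add: cycles_def)
      ultimately show ?thesis using q_eq_iff[OF F(1) c[OF F(1)] p_in[OF ij c[OF F(2)]]] by simp
    qed
    then show "x \<in> limit_set" unfolding limit_set_def a(2) invariant_def using c
      by (intro CollectI exI[of _ ?c]) simp
  qed
  show "limit_set \<subseteq> invariant ` cocycles cycles chain_map"
  proof
    fix x assume "x \<in> limit_set"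
    then obtain c where c: "\<And>i. i \<in> Field I \<Longrightarrow> c i \<in> K i"
      and cc: "\<And>i j. i \<triangleleft> j \<Longrightarrow> q i (c i) = q i (p i (c j))" and x: "x = (\<lambda>i\<in>Field I. q i (c i))"
      unfolding limit_set_def by blast
    have dc: "delta c i \<in> chains i" if "i \<in> Field I" for i by (rule delta_chains) (rule that, rule c[OF that])
    define a where "a i j = delta c i - chain_map i (delta c j)" for i j
    have "a i j \<in> cycles i" if ij: "i \<triangleleft> j" for i j
    proof -
      note F = ltD[OF ij]
      note ch = dc[OF F(1)] chain_map_chains[OF ij dc[OF F(2)]]
      have "Sum_any (a i j) = c i - p i (c j)"
        unfolding a_def using Sum_any_minus[OF ch F(1)] Sum_any_chain(2)[OF dc[OF F(2)] F(2) ij]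
        by (simp add: Sum_any_delta)
      then have "q i (Sum_any (a i j)) = q i 0"
        using q_eq_iff[OF F(1) c[OF F(1)] p_in[OF ij c[OF F(2)]]] cc[OF ij] by simp
      moreover have "a i j \<in> chains i" unfolding a_def using chains_minus[OF F(1) ch] .
      ultimately show ?thesis by (simp add: cycles_def)
    qed
    moreover have "a i k = a i j + chain_map i (a j k)" if ij: "i \<triangleleft> j" and jk: "j \<triangleleft> k" for i j k
      unfolding a_def
      using chain_map_minus[OF ij dc chain_map_chains[OF jk dc]] ltD[OF jk] chain_map_P[OF ij jk dc] by simp
    ultimately have a: "a \<in> cocycles cycles chain_map" by (simp add: cocycles_def)
    have "lim_chain a i s = delta c i s" if i: "i \<in> Field I" for i s
    proof (cases "s \<in> Field I")
      case True
      obtain j where j: "i \<triangleleft> j" "s \<triangleleft> j" using above2[OF i True] by blast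
      then have "s \<noteq> j" using lt_irrefl by blast
      then show ?thesis
        using lim_chain_eq[OF a j] p_zero[OF j(1)] by (simp add: a_def delta_def)
    next
      case False
      then show ?thesis using i by (auto simp: lim_chain_def delta_def)
    qed
    then have "lim_chain a i = delta c i" if "i \<in> Field I" for i using that by blast
    then have "invariant a = x"
      unfolding invariant_def x by (intro restrict_ext) (simp add: Sum_any_delta)
    then show "x \<in> invariant ` cocycles cycles chain_map" using a by blast
  qed
qed

text \<open>
  Chains \<open>y i\<close> with the same coboundary as \<open>a - b\<close> are unique, because the inverse limit of the chains is
  trivial: comparing values at \<open>s\<close> for \<open>j\<close> beyond \<open>s\<close> shows that \<open>y i\<close> is the difference of the limit
  chains.
\<close>

lemma invariant_eq_iff:
  assumes a: "a \<in> cocycles cycles chain_map" and b: "b \<in> cocycles cycles chain_map"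
  shows "invariant a = invariant b \<longleftrightarrow> cohomologous cycles chain_map a b"
proof -
  note cha = lim_chain_chains[OF a] and chb = lim_chain_chains[OF b]
  have inv: "invariant a = invariant b \<longleftrightarrow>
      (\<forall>i\<in>Field I. lim_chain a i - lim_chain b i \<in> cycles i)"
  proof -
    have "invariant a = invariant b \<longleftrightarrow>
        (\<forall>i\<in>Field I. q i (Sum_any (lim_chain a i)) = q i (Sum_any (lim_chain b i)))"
      unfolding invariant_def by (auto simp: fun_eq_iff restrict_def)
    moreover have "q i (Sum_any (lim_chain a i)) = q i (Sum_any (lim_chain b i)) \<longleftrightarrow>
        lim_chain a i - lim_chain b i \<in> cycles i" if i: "i \<in> Field I" for i
      using q_eq_iff[OF i Sum_any_chain(1)[OF cha i] Sum_any_chain(1)[OF chb i]]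
        chains_minus[OF i cha chb] Sum_any_minus[OF cha chb i] i by (simp add: cycles_def)
    ultimately show ?thesis by blast
  qed
  show ?thesis
  proof
    assume "invariant a = invariant b"
    moreover have "a i j - b i j = (lim_chain a i - lim_chain b i) - chain_map i (lim_chain a j - lim_chain b j)"
      if ij: "i \<triangleleft> j" for i j
      using cocycle_eq_lim_chain[OF a ij] cocycle_eq_lim_chain[OF b ij]
        chain_map_minus[OF ij cha chb] ltD[OF ij] by simp
    ultimately show "cohomologous cycles chain_map a b"
      unfolding cohomologous_def inv by (intro exI[of _ "\<lambda>i. lim_chain a i - lim_chain b i"]) blast
  next
    assume "cohomologous cycles chain_map a b"
    then obtain y where y: "\<And>i. i \<in> Field I \<Longrightarrow> y i \<in> cycles i"
      and ab: "\<And>i j. i \<triangleleft> j \<Longrightarrow> a i j - b i j = y i - chain_map i (y j)"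
      unfolding cohomologous_def by blast
    have "(lim_chain a i - lim_chain b i) s = y i s" if i: "i \<in> Field I" for i s
    proof (cases "s \<in> Field I")
      case True
      obtain j where j: "i \<triangleleft> j" "s \<triangleleft> j" using above2[OF i True] by blast
      have "y j s = 0" using chainsD(3)[OF cycles_chains[OF y[OF ltD(2)[OF j(1)]]] j(2)] .
      moreover have "a i j s - b i j s = y i s - p i (y j s)"
        using fun_cong[OF ab[OF j(1)], of s] by simp
      ultimately show ?thesis
        using lim_chain_eq[OF a j] lim_chain_eq[OF b j] p_zero[OF j(1)] by simp
    next
      case False
      then show ?thesis
        using chainsD(4)[OF cycles_chains[OF y[OF i]] False] by (simp add: lim_chain_def)
    qed
    then have "lim_chain a i - lim_chain b i = y i" if "i \<in> Field I" for i using that by blast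
    then show "invariant a = invariant b" unfolding inv using y by simp
  qed
qed

text \<open>
  The long exact sequence for cycles, chains and the quotients \<open>K i / N i\<close>, with both limits of the chains
  trivial.
\<close>

theorem quotient_limit_realises_limit:
  fixes r :: "'a rel"
  assumes r: "Card_order r" "natLeq <o r" and Ir: "|Field I| <o r"
    and Kr: "\<And>i. i \<in> Field I \<Longrightarrow> |K i| <o r"
  shows "\<exists>(G :: 'k \<Rightarrow> 'a monoid) h. inverse_system I G h \<and>
           (\<forall>i\<in>Field I. |carrier (G i)| <o r) \<and> |carrier (quotient_limit I G h)| =o |limit_set|"
proof -
  have cinf: "Cinfinite r"
    using r cinfinite_mono[OF ordLess_imp_ordLeq natLeq_cinfinite] by blast
  have small: "|cycles i| <o r" if i: "i \<in> Field I" for i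
  proof -
    have "cycles i \<subseteq> {f. finite {s. f s \<noteq> 0} \<and> {s. f s \<noteq> 0} \<subseteq> Field I \<and> range f \<subseteq> K i}"
      by (auto simp: cycles_def chains_def)
    then have "|cycles i| \<le>o |Fpow (Field I \<times> K i)|"
      by (rule ordLeq_transitive[OF card_of_mono1 card_of_finitely_supported])
    moreover have "|Fpow (Field I \<times> K i)| <o r"
      using card_of_Fpow_ordLess[OF card_of_Times_ordLess[OF Ir Kr[OF i] cinf] r(2,1)] .
    ultimately show ?thesis by (rule ordLeq_ordLess_trans)
  qed
  have rU: "r \<le>o |UNIV :: 'a set|"
    by (rule ordIso_ordLeq_trans[OF ordIso_symmetric[OF card_of_Field_ordIso[OF r(1)]]]) (rule card_of_mono1, simp)
  have "\<exists>(G :: 'k \<Rightarrow> 'a monoid) h. inverse_system I G h \<and>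
           (\<forall>i\<in>Field I. |carrier (G i)| =o |cycles i| ) \<and> |carrier (quotient_limit I G h)| =o |limit_set|"
  proof (rule realise_in_type[of cycles chain_map])
    show "0 \<in> cycles i" if "i \<in> Field I" for i
      using K_zero[OF that] by (auto simp: cycles_def chains_def)
    show "x - y \<in> cycles i" if i: "i \<in> Field I" and x: "x \<in> cycles i" and y: "y \<in> cycles i" for i x y
    proof -
      note ch = cycles_chains[OF x] cycles_chains[OF y]
      have "q i (Sum_any x) = q i (Sum_any y)" using x y by (simp add: cycles_def)
      then have "q i (Sum_any (x - y)) = q i 0"
        using q_eq_iff[OF i Sum_any_chain(1)[OF ch(1) i] Sum_any_chain(1)[OF ch(2) i]]
          Sum_any_minus[OF ch i] by simp
      then show ?thesis using chains_minus[OF i ch] by (simp add: cycles_def)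
    qed
    show "chain_map i (x + y) = chain_map i x + chain_map i y" if "i \<triangleleft> j" "x \<in> cycles j" "y \<in> cycles j" for i j x y
      using p_add[OF that(1) chainsD(2)[OF cycles_chains[OF that(2)]] chainsD(2)[OF cycles_chains[OF that(3)]]]
      by (simp add: fun_eq_iff)
    show "chain_map i x \<in> cycles i" if ij: "i \<triangleleft> j" and x: "x \<in> cycles j" for i j x
    proof -
      note ch = cycles_chains[OF x] and S = Sum_any_chain[OF cycles_chains[OF x] ltD(2)[OF ij]]
      have "q j (Sum_any x) = q j 0" using x by (simp add: cycles_def)
      then have "q i (Sum_any (chain_map i x)) = q i 0" using q_p[OF ij S(1)] S(2)[OF ij] by simp
      then show ?thesis using chain_map_chains[OF ij ch] by (simp add: cycles_def)
    qed
    show "chain_map i (chain_map j x) = chain_map i x" if "i \<triangleleft> j" "j \<triangleleft> k" "x \<in> cycles k" for i j k x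
      using chain_map_P that cycles_chains by blast
    show "|cycles i| \<le>o |UNIV :: 'a set|" if "i \<in> Field I" for i
      by (rule ordLeq_transitive[OF ordLess_imp_ordLeq[OF small[OF that]] rU])
    show "invariant ` cocycles cycles chain_map = limit_set" by (rule invariant_image)
    show "invariant a = invariant b \<longleftrightarrow> cohomologous cycles chain_map a b"
      if "a \<in> cocycles cycles chain_map" "b \<in> cocycles cycles chain_map" for a b
      using that by (rule invariant_eq_iff)
  qed
  then show ?thesis using small ordIso_ordLess_trans by meson
qed

end

section \<open>Trees and free abelian groups\<close>

text \<open>
  Levels \<open>T i\<close> with restriction maps. The map to level \<open>i\<close> is one function for all higher levels, which
  spares an index and costs no generality, as elements can be tagged by their level.
\<close>

locale tree = uncountable_cofinality I for I :: "'k rel" +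
  fixes T :: "'k \<Rightarrow> 'v set" and \<pi> :: "'k \<Rightarrow> 'v \<Rightarrow> 'v"
  assumes proj_in: "i \<triangleleft> j \<Longrightarrow> x \<in> T j \<Longrightarrow> \<pi> i x \<in> T i"
    and proj_proj: "i \<triangleleft> j \<Longrightarrow> j \<triangleleft> k \<Longrightarrow> x \<in> T k \<Longrightarrow> \<pi> i (\<pi> j x) = \<pi> i x"
begin

definition branches :: "('k \<Rightarrow> 'v) set" where
  "branches = {x \<in> (\<Pi>\<^sub>E i\<in>Field I. T i). \<forall>i j. i \<triangleleft> j \<longrightarrow> x i = \<pi> i (x j)}"

lemma branches_ext:
  assumes "x \<in> branches" "y \<in> branches" "\<And>i. i \<in> Field I \<Longrightarrow> x i = y i"
  shows "x = y"
proof (rule PiE_ext)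
  show "x \<in> (\<Pi>\<^sub>E i\<in>Field I. T i)" "y \<in> (\<Pi>\<^sub>E i\<in>Field I. T i)" using assms(1,2) by (auto simp: branches_def)
qed (rule assms(3))

abbreviation push :: "'k \<Rightarrow> ('v \<Rightarrow>\<^sub>0 int) \<Rightarrow> 'v \<Rightarrow>\<^sub>0 int" where
  "push i \<equiv> frag_extend (frag_of \<circ> \<pi> i)"

lemma keys_push: "Poly_Mapping.keys (push i c) \<subseteq> \<pi> i ` Poly_Mapping.keys c"
  using keys_frag_extend[of "frag_of \<circ> \<pi> i" c] by (auto simp: keys_frag_of)

text \<open>
  Projecting to a lower level can only shrink the support, so the sizes of the supports are monotone.
  Since \<open>\<kappa>\<close> has uncountable cofinality they are bounded, hence constant from some \<open>i0\<close> on. From there the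
  projections are bijections between supports, and each point of the support at \<open>i0\<close> extends to one
  branch; the coefficients at \<open>i0\<close> are those of the combination.
\<close>

lemma coherent_chain_from_branches:
  assumes cT: "\<And>i. i \<in> Field I \<Longrightarrow> Poly_Mapping.keys (c i) \<subseteq> T i"
    and cc: "\<And>i j. i \<triangleleft> j \<Longrightarrow> c i = push i (c j)"
  shows "\<exists>b. Poly_Mapping.keys b \<subseteq> branches \<and> (\<forall>i\<in>Field I. c i = frag_extend (frag_of \<circ> (\<lambda>x. x i)) b)"
proof -
  define n where "n i = card (Poly_Mapping.keys (c i))" for i
  have sub: "Poly_Mapping.keys (c i) \<subseteq> \<pi> i ` Poly_Mapping.keys (c j)" if "i \<triangleleft> j" for i j
    using keys_push[of i "c j"] cc[OF that] by simp
  have mono: "n i \<le> n j" if "i \<triangleleft> j" for i j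
    unfolding n_def using surj_card_le[OF finite_keys sub[OF that]] .
  obtain i0 where i0: "i0 \<in> Field I" "\<And>j. i0 \<triangleleft> j \<Longrightarrow> n j = n i0"
  proof -
    have "\<exists>i\<in>Field I. \<forall>j. i \<triangleleft> j \<longrightarrow> n j = n i"
    proof (rule ccontr)
      assume neg: "\<not> ?thesis"
      have "\<exists>i\<in>Field I. m \<le> n i" for m
      proof (induction m)
        case 0
        then show ?case using nonempty by blast
      next
        case (Suc m)
        then obtain i where i: "i \<in> Field I" "m \<le> n i" by blast
        then obtain j where "i \<triangleleft> j" "n j \<noteq> n i" using neg by blast
        then show ?case using mono[of i j] i ltD(2)[of i j] by (intro bexI[of _ j]) auto
      qed
      then obtain u where u: "\<And>m. u m \<in> Field I" "\<And>m. m \<le> n (u m)" by metis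
      obtain j where j: "\<And>m. u m \<triangleleft> j" using above_countable[of "range u"] u(1) by auto
      show False using mono[OF j[of "Suc (n j)"]] u(2)[of "Suc (n j)"] by simp
    qed
    then show thesis using that by blast
  qed
  have keys_img: "\<pi> i ` Poly_Mapping.keys (c j) = Poly_Mapping.keys (c i)"
    and inj: "inj_on (\<pi> i) (Poly_Mapping.keys (c j))"
    if ij: "i \<triangleleft> j" and i: "i = i0 \<or> i0 \<triangleleft> i" for i j
  proof -
    have "n j = n i" using i i0(2) ij lt_trans[OF _ ij] by metis
    then have *: "card (\<pi> i ` Poly_Mapping.keys (c j)) \<le> card (Poly_Mapping.keys (c i))"
      using card_image_le[of "Poly_Mapping.keys (c j)" "\<pi> i"] by (simp add: n_def)
    then show "\<pi> i ` Poly_Mapping.keys (c j) = Poly_Mapping.keys (c i)"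
      using card_seteq[OF _ sub[OF ij]] by simp
    then have "card (\<pi> i ` Poly_Mapping.keys (c j)) = card (Poly_Mapping.keys (c j))"
      using \<open>n j = n i\<close> by (simp add: n_def)
    then show "inj_on (\<pi> i) (Poly_Mapping.keys (c j))" by (intro eq_card_imp_inj_on) auto
  qed
  define \<sigma> where "\<sigma> k = inv_into (Poly_Mapping.keys (c k)) (\<pi> i0)" for k
  have \<sigma>: "\<sigma> k t \<in> Poly_Mapping.keys (c k)" "\<pi> i0 (\<sigma> k t) = t"
    if k: "i0 \<triangleleft> k" and t: "t \<in> Poly_Mapping.keys (c i0)" for k t
  proof -
    have "t \<in> \<pi> i0 ` Poly_Mapping.keys (c k)" using keys_img[OF k] t by simp
    then show "\<sigma> k t \<in> Poly_Mapping.keys (c k)" "\<pi> i0 (\<sigma> k t) = t"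
      unfolding \<sigma>_def by (rule inv_into_into, rule f_inv_into_f)
  qed
  have \<sigma>_inv: "\<sigma> k (\<pi> i0 u) = u" if k: "i0 \<triangleleft> k" and u: "u \<in> Poly_Mapping.keys (c k)" for k u
    unfolding \<sigma>_def using inv_into_f_f[OF inj[OF k] u] by simp
  have \<sigma>_proj: "\<pi> k (\<sigma> k' t) = \<sigma> k t"
    if k: "i0 \<triangleleft> k" and kk: "k \<triangleleft> k'" and t: "t \<in> Poly_Mapping.keys (c i0)" for k k' t
  proof -
    note s = \<sigma>[OF lt_trans[OF k kk] t]
    have "\<pi> k (\<sigma> k' t) \<in> Poly_Mapping.keys (c k)" using keys_img[OF kk] k s(1) by blast
    moreover have "\<pi> i0 (\<pi> k (\<sigma> k' t)) = t"
      using proj_proj[OF k kk] s cT[OF ltD(2)[OF kk]] by auto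
    ultimately show ?thesis using \<sigma>_inv[OF k] by metis
  qed
  define br where "br t = (\<lambda>j\<in>Field I. \<pi> j (\<sigma> (SOME k. i0 \<triangleleft> k \<and> j \<triangleleft> k) t))" for t
  have br: "br t j = \<pi> j (\<sigma> k t)" if k: "i0 \<triangleleft> k" and jk: "j \<triangleleft> k" and t: "t \<in> Poly_Mapping.keys (c i0)"
    for j k t
  proof -
    have *: "\<pi> j (\<sigma> k t) = \<pi> j (\<sigma> k' t)" if k: "i0 \<triangleleft> k" and jk: "j \<triangleleft> k" and kk: "k \<triangleleft> k'" for k k'
      using \<sigma>_proj[OF k kk t] proj_proj[OF jk kk, of "\<sigma> k' t"] \<sigma>(1)[OF lt_trans[OF k kk] t]
        cT[OF ltD(2)[OF kk]] by auto
    define k' where "k' = (SOME k. i0 \<triangleleft> k \<and> j \<triangleleft> k)"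
    have k': "i0 \<triangleleft> k'" "j \<triangleleft> k'" unfolding k'_def using k jk by (metis (mono_tags, lifting) someI)+
    have "\<pi> j (\<sigma> k' t) = \<pi> j (\<sigma> k t)"
      using lt_linear[OF ltD(2)[OF k] ltD(2)[OF k'(1)]] *[OF k jk] *[OF k'] by metis
    then show ?thesis using ltD(1)[OF jk] by (simp add: br_def k'_def)
  qed
  have br_branch: "br t \<in> branches" if t: "t \<in> Poly_Mapping.keys (c i0)" for t
  proof -
    have "br t j \<in> T j" if j: "j \<in> Field I" for j
    proof -
      obtain k where k: "i0 \<triangleleft> k" "j \<triangleleft> k" using above2[OF i0(1) j] by blast
      then show ?thesis
        using br[OF k t] proj_in[OF k(2)] \<sigma>(1)[OF k(1) t] cT[OF ltD(2)[OF k(1)]] by auto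
    qed
    moreover have "br t i = \<pi> i (br t j)" if ij: "i \<triangleleft> j" for i j
    proof -
      obtain k where k: "i0 \<triangleleft> k" "j \<triangleleft> k" using above2[OF i0(1) ltD(2)[OF ij]] by blast
      then show ?thesis
        using br[OF k t] br[OF k(1) lt_trans[OF ij k(2)] t] proj_proj[OF ij k(2), of "\<sigma> k t"]
          \<sigma>(1)[OF k(1) t] cT[OF ltD(2)[OF k(1)]] by auto
    qed
    ultimately show ?thesis by (simp add: branches_def br_def PiE_iff)
  qed
  define b where "b = frag_extend (frag_of \<circ> br) (c i0)"
  have "Poly_Mapping.keys b \<subseteq> br ` Poly_Mapping.keys (c i0)"
    using keys_frag_extend[of "frag_of \<circ> br" "c i0"] by (auto simp: b_def keys_frag_of)
  then have kb: "Poly_Mapping.keys b \<subseteq> branches" using br_branch by blast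
  have "c j = frag_extend (frag_of \<circ> (\<lambda>x. x j)) b" if j: "j \<in> Field I" for j
  proof -
    obtain k where k: "i0 \<triangleleft> k" "j \<triangleleft> k" using above2[OF i0(1) j] by blast
    have "frag_extend (frag_of \<circ> (\<lambda>x. x j)) b = frag_extend (frag_of \<circ> (\<lambda>x. x j) \<circ> br) (c i0)"
      unfolding b_def by (rule frag_extend_compose)
    also have "\<dots> = frag_extend (frag_of \<circ> \<pi> j \<circ> \<sigma> k) (c i0)"
      by (rule frag_extend_eq) (simp add: br[OF k])
    also have "\<dots> = frag_extend (frag_of \<circ> \<pi> j \<circ> \<sigma> k) (push i0 (c k))"
      using cc[OF k(1)] by simp
    also have "\<dots> = frag_extend (frag_of \<circ> \<pi> j \<circ> \<sigma> k \<circ> \<pi> i0) (c k)"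
      by (rule frag_extend_compose)
    also have "\<dots> = push j (c k)"
      by (rule frag_extend_eq) (simp add: \<sigma>_inv[OF k(1)])
    also have "\<dots> = c j" using cc[OF k(2)] by simp
    finally show ?thesis by simp
  qed
  with kb show ?thesis by blast
qed

text \<open>
  Free abelian groups on the levels: every branch gives an element of their limit, and
  every element is a finite integer combination of branches.
\<close>

theorem quotient_limit_counts_branches:
  fixes r :: "'a rel"
  assumes r: "Card_order r" "natLeq <o r" and Ir: "|Field I| <o r"
    and Tr: "\<And>i. i \<in> Field I \<Longrightarrow> |T i| <o r" and inf: "infinite branches"
  shows "\<exists>(G :: 'k \<Rightarrow> 'a monoid) h. inverse_system I G h \<and>
           (\<forall>i\<in>Field I. |carrier (G i)| <o r) \<and> |carrier (quotient_limit I G h)| =o |branches|"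
proof -
  have cinf: "Cinfinite r"
    using r cinfinite_mono[OF ordLess_imp_ordLeq natLeq_cinfinite] by blast
  interpret C: coefficient_system I "\<lambda>i. {c :: 'v \<Rightarrow>\<^sub>0 int. Poly_Mapping.keys c \<subseteq> T i}" push "\<lambda>_ c. c"
  proof unfold_locales
    show "0 \<in> {c. Poly_Mapping.keys c \<subseteq> T i}" for i by simp
    show "x - y \<in> {c. Poly_Mapping.keys c \<subseteq> T i}"
      if "x \<in> {c. Poly_Mapping.keys c \<subseteq> T i}" "y \<in> {c. Poly_Mapping.keys c \<subseteq> T i}"
      for i and x y :: "'v \<Rightarrow>\<^sub>0 int"
      using keys_diff[of x y] that by blast
    show "push i (x + y) = push i x + push i y" for i x y by (rule frag_extend_add)
    show "push i x \<in> {c. Poly_Mapping.keys c \<subseteq> T i}"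
      if "i \<triangleleft> j" "x \<in> {c. Poly_Mapping.keys c \<subseteq> T j}" for i j x
      using keys_push[of i x] that proj_in[OF that(1)] by blast
    show "push i (push j x) = push i x"
      if "i \<triangleleft> j" "j \<triangleleft> k" "x \<in> {c. Poly_Mapping.keys c \<subseteq> T k}" for i j k x
      unfolding frag_extend_compose
      by (rule frag_extend_eq) (use proj_proj[OF that(1,2)] that(3) in auto)
    show "push i x = 0" if "i \<triangleleft> j" "x = 0" for i j x using that by simp
  qed auto
  have Kr: "|{c :: 'v \<Rightarrow>\<^sub>0 int. Poly_Mapping.keys c \<subseteq> T i}| <o r" if i: "i \<in> Field I" for i
  proof -
    have "|UNIV :: int set| \<le>o natLeq"
      by (rule countable_ordLeq_infinite[OF _ natLeq_Cinfinite]) simp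
    then have "|UNIV :: int set| <o r" using r(2) by (rule ordLeq_ordLess_trans)
    then have "|Fpow (T i \<times> (UNIV :: int set))| <o r"
      using card_of_Fpow_ordLess[OF card_of_Times_ordLess[OF Tr[OF i] _ cinf] r(2,1)] by blast
    with card_of_frag show ?thesis by (rule ordLeq_ordLess_trans)
  qed
  have "|C.limit_set| \<le>o |branches|"
  proof -
    have "C.limit_set \<subseteq> (\<lambda>b. \<lambda>i\<in>Field I. frag_extend (frag_of \<circ> (\<lambda>x. x i)) b) ` {b. Poly_Mapping.keys b \<subseteq> branches}"
    proof
      fix x assume "x \<in> C.limit_set"
      then obtain c where "x = (\<lambda>i\<in>Field I. c i)" "\<And>i. i \<in> Field I \<Longrightarrow> Poly_Mapping.keys (c i) \<subseteq> T i"
        "\<And>i j. i \<triangleleft> j \<Longrightarrow> c i = push i (c j)"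
        unfolding C.limit_set_def by blast
      moreover from coherent_chain_from_branches[OF this(2,3)] obtain b where
        "Poly_Mapping.keys b \<subseteq> branches" "\<forall>i\<in>Field I. c i = frag_extend (frag_of \<circ> (\<lambda>x. x i)) b" by blast
      ultimately show "x \<in> (\<lambda>b. \<lambda>i\<in>Field I. frag_extend (frag_of \<circ> (\<lambda>x. x i)) b) ` {b. Poly_Mapping.keys b \<subseteq> branches}"
        by (intro image_eqI[of _ _ b]) (auto intro: restrict_ext)
    qed
    then have "|C.limit_set| \<le>o |{b :: ('k \<Rightarrow> 'v) \<Rightarrow>\<^sub>0 int. Poly_Mapping.keys b \<subseteq> branches}|"
      by (rule surj_imp_ordLeq)
    also have "|{b :: ('k \<Rightarrow> 'v) \<Rightarrow>\<^sub>0 int. Poly_Mapping.keys b \<subseteq> branches}| \<le>o |Fpow (branches \<times> (UNIV :: int set))|"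
      by (rule card_of_frag)
    also have "|Fpow (branches \<times> (UNIV :: int set))| \<le>o |branches|"
    proof (rule card_of_Fpow_ordLeq)
      have "|UNIV :: int set| \<le>o |branches|"
        by (rule countable_ordLeq_infinite) (simp_all add: Cinfinite_card_of inf)
      then show "|branches \<times> (UNIV :: int set)| \<le>o |branches|"
        using card_of_Times_infinite[OF inf, of "UNIV :: int set"] ordIso_imp_ordLeq by blast
    qed (rule Cinfinite_card_of[OF inf])
    finally show ?thesis .
  qed
  moreover have "|branches| \<le>o |C.limit_set|"
  proof (rule card_of_ordLeqI)
    show "inj_on (\<lambda>x. \<lambda>i\<in>Field I. frag_of (x i)) branches"
    proof (rule inj_onI)
      fix x y assume x: "x \<in> branches" and y: "y \<in> branches"
        and eq: "(\<lambda>i\<in>Field I. frag_of (x i)) = (\<lambda>i\<in>Field I. frag_of (y i))"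
      have "x i = y i" if "i \<in> Field I" for i
        using fun_cong[OF eq, of i] that by (simp add: frag_of_eq)
      with x y show "x = y" by (rule branches_ext)
    qed
    show "(\<lambda>i\<in>Field I. frag_of (x i)) \<in> C.limit_set" if x: "x \<in> branches" for x
      unfolding C.limit_set_def using x ltD
      by (intro CollectI exI[of _ "\<lambda>i. frag_of (x i)"]) (auto simp: branches_def PiE_iff keys_frag_of)
  qed
  ultimately have "|C.limit_set| =o |branches|" by (simp add: ordIso_iff_ordLeq)
  then show ?thesis
    using C.quotient_limit_realises_limit[OF r Ir Kr] ordIso_transitive by blast
qed

end

section \<open>Trees with many branches\<close>

text \<open>
  A point of \<open>M\<close> is revealed at the first level whose piece contains it and shows as \<open>z\<close> before. A branch
  reveals at most one point, so the branches correspond to the elements of \<open>M\<close>.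
\<close>

lemma (in uncountable_cofinality) filtration_tree:
  assumes L: "\<And>i j. i \<triangleleft> j \<Longrightarrow> L i \<subseteq> L j" and cover: "M \<subseteq> (\<Union>i\<in>Field I. L i)" and z: "z \<in> M"
  shows "tree I (\<lambda>i. insert z (M \<inter> L i)) (\<lambda>i x. if x \<in> L i then x else z)"
    and "|tree.branches I (\<lambda>i. insert z (M \<inter> L i)) (\<lambda>i x. if x \<in> L i then x else z)| =o |M|"
proof -
  let ?\<pi> = "\<lambda>i x. if x \<in> L i then x else z" and ?T = "\<lambda>i. insert z (M \<inter> L i)"
  show "tree I ?T ?\<pi>"
    by unfold_locales (use L in auto)
  then interpret tree I ?T ?\<pi> .
  let ?b = "\<lambda>x. \<lambda>i\<in>Field I. ?\<pi> i x"
  have img: "branches = ?b ` M"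
  proof
    show "?b ` M \<subseteq> branches"
      using L ltD by (fastforce simp: branches_def)
    show "branches \<subseteq> ?b ` M"
    proof
      fix x assume x: "x \<in> branches"
      then have xT: "\<And>i. i \<in> Field I \<Longrightarrow> x i \<in> ?T i" and xx: "\<And>i j. i \<triangleleft> j \<Longrightarrow> x i = ?\<pi> i (x j)"
        and xe: "x \<in> extensional (Field I)"
        by (auto simp: branches_def PiE_iff)
      show "x \<in> ?b ` M"
      proof (cases "\<exists>i\<in>Field I. x i \<noteq> z")
        case True
        then obtain i where i: "i \<in> Field I" "x i \<noteq> z" by blast
        have "x j = ?\<pi> j (x i)" if j: "j \<in> Field I" for j
        proof -
          consider "j \<triangleleft> i" | "j = i" | "i \<triangleleft> j" using lt_linear[OF j i(1)] by blast
          then show ?thesis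
          proof cases
            case 3
            then show ?thesis using xx[OF 3] i L[OF 3] xT[OF i(1)] by (auto split: if_splits)
          qed (use xx i xT in auto)
        qed
        then have "x = ?b (x i)" using xe by (auto simp: extensional_def fun_eq_iff)
        then show ?thesis using xT[OF i(1)] i(2) by blast
      next
        case False
        then have "x = ?b z" using xe by (auto simp: extensional_def fun_eq_iff)
        then show ?thesis using z by blast
      qed
    qed
  qed
  have "inj_on ?b M"
  proof (rule inj_onI)
    fix x y assume xy: "x \<in> M" "y \<in> M" and eq: "?b x = ?b y"
    obtain i j where ij: "i \<in> Field I" "x \<in> L i" "j \<in> Field I" "y \<in> L j" using cover xy by blast
    obtain k where k: "i \<triangleleft> k" "j \<triangleleft> k" using above2 ij by blast
    show "x = y"
      using fun_cong[OF eq, of k] subsetD[OF L[OF k(1)] ij(2)] subsetD[OF L[OF k(2)] ij(4)]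
        ltD(2)[OF k(1)] by simp
  qed
  then show "|branches| =o |M|"
    unfolding img by (meson bij_betw_imageI card_of_ordIso ordIso_symmetric)
qed

text \<open>
  Level \<open>i\<close> contains what is known of a function at stage \<open>i\<close>: its values at arguments before \<open>i\<close>, as
  far as they lie in \<open>L i\<close>. Truncating the values as well as the domain keeps levels below \<open>\<lambda>\<close>
  while every function from \<open>\<kappa>\<close> to \<open>\<lambda>\<close> still gives its own branch.
\<close>

lemma (in uncountable_cofinality) function_tree:
  fixes L :: "'k \<Rightarrow> 'a set" and z :: 'a
  assumes L: "\<And>i j. i \<triangleleft> j \<Longrightarrow> L i \<subseteq> L j" and cover: "V \<subseteq> (\<Union>i\<in>Field I. L i)"
  defines "T \<equiv> \<lambda>i. {t. (\<forall>s. s \<triangleleft> i \<longrightarrow> t s \<in> insert z (L i)) \<and> (\<forall>s. \<not> s \<triangleleft> i \<longrightarrow> t s = z)}"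
    and "\<pi> \<equiv> \<lambda>i t s. if s \<triangleleft> i \<and> t s \<in> L i then t s else z"
  shows "tree I T \<pi>" and "|Func (Field I) V| \<le>o |tree.branches I T \<pi>|"
    and "|T i| \<le>o |Func (underS I i) (insert z (L i))|"
proof -
  have L': "x \<in> L j" if "i \<triangleleft> j" "x \<in> L i" for i j x using L[OF that(1)] that(2) by blast
  have \<pi>_T: "\<pi> i t \<in> T i" for i t by (simp add: T_def \<pi>_def)
  have \<pi>_\<pi>: "\<pi> i (\<pi> j t) = \<pi> i t" if "i \<triangleleft> j" for i j t
    using L'[OF that] lt_trans[OF _ that] by (auto simp: \<pi>_def fun_eq_iff)
  show "tree I T \<pi>" by unfold_locales (use \<pi>_T \<pi>_\<pi> in auto)
  then interpret tree I T \<pi> .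
  show "|Func (Field I) V| \<le>o |branches|"
  proof (rule card_of_ordLeqI)
    show "inj_on (\<lambda>f. \<lambda>i\<in>Field I. \<pi> i f) (Func (Field I) V)"
    proof (rule inj_onI, rule ext)
      fix f g s
      assume f: "f \<in> Func (Field I) V" and g: "g \<in> Func (Field I) V"
        and eq: "(\<lambda>i\<in>Field I. \<pi> i f) = (\<lambda>i\<in>Field I. \<pi> i g)"
      show "f s = g s"
      proof (cases "s \<in> Field I")
        case True
        then have "f s \<in> V" "g s \<in> V" using f g by (simp_all add: Func_def)
        then obtain i j where ij: "i \<in> Field I" "f s \<in> L i" "j \<in> Field I" "g s \<in> L j"
          using cover by blast
        obtain k where k: "i \<triangleleft> k" "j \<triangleleft> k" "s \<triangleleft> k" using above3 ij(1,3) True by blast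
        have "\<pi> k f = \<pi> k g" using fun_cong[OF eq, of k] ltD(2)[OF k(1)] by simp
        then have "\<pi> k f s = \<pi> k g s" by simp
        then show ?thesis using L'[OF k(1) ij(2)] L'[OF k(2) ij(4)] k(3) by (simp add: \<pi>_def)
      next
        case False
        then show ?thesis using f g by (simp add: Func_def)
      qed
    qed
    show "(\<lambda>i\<in>Field I. \<pi> i f) \<in> branches" for f
      using ltD by (auto simp: branches_def \<pi>_T \<pi>_\<pi>)
  qed
  show "|T i| \<le>o |Func (underS I i) (insert z (L i))|"
  proof (rule card_of_ordLeqI)
    have S: "underS I i = {s. s \<triangleleft> i}" by (auto simp: underS_def lt_def)
    show "inj_on (\<lambda>t s. if s \<triangleleft> i then t s else undefined) (T i)"
    proof (rule inj_onI, rule ext)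
      fix t u s
      assume tu: "t \<in> T i" "u \<in> T i"
        and eq: "(\<lambda>s. if s \<triangleleft> i then t s else undefined) = (\<lambda>s. if s \<triangleleft> i then u s else undefined)"
      show "t s = u s" using fun_cong[OF eq, of s] tu by (cases "s \<triangleleft> i") (auto simp: T_def)
    qed
    show "(\<lambda>s. if s \<triangleleft> i then t s else undefined) \<in> Func (underS I i) (insert z (L i))"
      if "t \<in> T i" for t
      using that by (auto simp: S Func_def T_def)
  qed
qed

section \<open>Trees with a prescribed number of branches\<close>

context uncountable_cofinality
begin

definition bdd :: "'k set \<Rightarrow> bool" where
  "bdd B \<longleftrightarrow> (\<exists>j\<in>Field I. \<forall>i\<in>B. i \<triangleleft> j)"

lemma bdd_empty: "bdd {}" using nonempty by (auto simp: bdd_def)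

lemma bdd_Un: "bdd B \<Longrightarrow> bdd C \<Longrightarrow> bdd (B \<union> C)"
proof -
  assume "bdd B" "bdd C"
  then obtain i j where ij: "i \<in> Field I" "\<forall>b\<in>B. b \<triangleleft> i" "j \<in> Field I" "\<forall>b\<in>C. b \<triangleleft> j"
    unfolding bdd_def by blast
  obtain k where "i \<triangleleft> k" "j \<triangleleft> k" using above2 ij by blast
  then show ?thesis using ij lt_trans ltD(2) unfolding bdd_def by blast
qed

text \<open>
  Strict domination of cardinal-valued functions modulo bounded sets. Cardinals are represented by
  sets.
\<close>

definition smaller_on :: "'k set \<Rightarrow> ('k \<Rightarrow> 'v set) \<Rightarrow> ('k \<Rightarrow> 'v set) \<Rightarrow> bool" where
  "smaller_on X \<phi>' \<phi> \<longleftrightarrow> (\<exists>B. bdd B \<and> (\<forall>i\<in>X - B. |\<phi>' i| <o |\<phi> i| ))"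

text \<open>
  A descending sequence has countably many bounded exceptional sets, and at an index beyond all of them
  it would give a descending sequence of cardinals.
\<close>

lemma wf_smaller_on: "wf {(\<phi>', \<phi> :: 'k \<Rightarrow> 'v set). smaller_on (Field I) \<phi>' \<phi>}"
proof (subst wf_iff_no_infinite_down_chain, rule notI, elim exE)
  fix f :: "nat \<Rightarrow> 'k \<Rightarrow> 'v set"
  assume "\<forall>n. (f (Suc n), f n) \<in> {(\<phi>', \<phi>). smaller_on (Field I) \<phi>' \<phi>}"
  then have "\<forall>n. \<exists>B j. j \<in> Field I \<and> (\<forall>i\<in>B. i \<triangleleft> j) \<and> (\<forall>i\<in>Field I - B. |f (Suc n) i| <o |f n i| )"
    unfolding smaller_on_def bdd_def mem_Collect_eq prod.case by meson
  then obtain B j where B: "\<And>n. j n \<in> Field I" "\<And>n i. i \<in> B n \<Longrightarrow> i \<triangleleft> j n"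
    "\<And>n i. i \<in> Field I \<Longrightarrow> i \<notin> B n \<Longrightarrow> |f (Suc n) i| <o |f n i|"
    by (metis Diff_iff)
  obtain k where k: "k \<in> Field I" "\<And>n. j n \<triangleleft> k" using above_countable[of "range j"] B(1) by auto
  have "k \<notin> B n" for n using B(2)[of k n] k(2)[of n] lt_asym by blast
  then have "|f (Suc n) k| <o |f n k|" for n using B(3) k(1) by blast
  then have "\<exists>g :: nat \<Rightarrow> 'v rel. \<forall>n. (g (Suc n), g n) \<in> ordLess"
    by (intro exI[of _ "\<lambda>n. |f n k|"]) simp
  moreover have "wf (ordLess :: 'v rel rel)" by (rule wf_ordLess)
  ultimately show False unfolding wf_iff_no_infinite_down_chain by blast
qed

end

context tree
begin

definition lev :: "('k \<Rightarrow> 'v) set \<Rightarrow> 'k \<Rightarrow> 'v set" where "lev F i = (\<lambda>x. x i) ` F"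

text \<open>
  All branches of the subtree spanned by \<open>F\<close>.
\<close>

definition closure :: "('k \<Rightarrow> 'v) set \<Rightarrow> ('k \<Rightarrow> 'v) set" where
  "closure F = {x \<in> branches. \<forall>i\<in>Field I. x i \<in> lev F i}"

lemma branchesD:
  assumes "x \<in> branches"
  shows "i \<in> Field I \<Longrightarrow> x i \<in> T i" and "i \<triangleleft> j \<Longrightarrow> x i = \<pi> i (x j)"
  using assms by (auto simp: branches_def PiE_iff)

lemma closure_branches: "closure F \<subseteq> branches" by (auto simp: closure_def)

lemma subset_closure: "F \<subseteq> branches \<Longrightarrow> F \<subseteq> closure F" by (auto simp: closure_def lev_def)

lemma lev_closure: "i \<in> Field I \<Longrightarrow> lev (closure F) i \<subseteq> lev F i"
  by (auto simp: closure_def lev_def)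

text \<open>
  The first component of a node never changes along a branch, so a branch of the union stays in one
  of the subtrees. Closures of families are turned into trees in this way.
\<close>

lemma disjoint_union_tree:
  assumes C: "\<And>X. X \<in> \<X> \<Longrightarrow> C X \<subseteq> branches"
  defines "T' \<equiv> \<lambda>i. SIGMA X:\<X>. lev (C X) i" and "\<pi>' \<equiv> \<lambda>i (X, v). (X, \<pi> i v)"
  shows "tree I T' \<pi>'" and "|tree.branches I T' \<pi>'| =o |SIGMA X:\<X>. closure (C X)|"
    and "i \<in> Field I \<Longrightarrow> T' i \<subseteq> \<X> \<times> T i"
proof -
  have lev_T: "lev (C X) i \<subseteq> T i" if "i \<in> Field I" "X \<in> \<X>" for X i
    using C[OF that(2)] branchesD(1) that(1) by (auto simp: lev_def)
  show "i \<in> Field I \<Longrightarrow> T' i \<subseteq> \<X> \<times> T i" using lev_T by (auto simp: T'_def)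
  show "tree I T' \<pi>'"
  proof unfold_locales
    show "\<pi>' i x \<in> T' i" if ij: "i \<triangleleft> j" and x: "x \<in> T' j" for i j x
    proof -
      obtain X y where "x = (X, y j)" "X \<in> \<X>" "y \<in> C X" using x by (auto simp: T'_def lev_def)
      moreover then have "\<pi> i (y j) = y i" using branchesD(2)[OF _ ij] C by (metis subsetD)
      ultimately show ?thesis by (auto simp: T'_def \<pi>'_def lev_def)
    qed
    show "\<pi>' i (\<pi>' j x) = \<pi>' i x" if "i \<triangleleft> j" "j \<triangleleft> k" "x \<in> T' k" for i j k x
      using that proj_proj[OF that(1,2)] lev_T[OF ltD(2)[OF that(2)]]
      by (auto simp: T'_def \<pi>'_def)
  qed
  then interpret D: tree I T' \<pi>' .
  have T'_iff: "v \<in> T' i \<longleftrightarrow> fst v \<in> \<X> \<and> snd v \<in> lev (C (fst v)) i" for v i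
    by (cases v) (auto simp: T'_def)
  have \<pi>'_eq: "\<pi>' i v = (fst v, \<pi> i (snd v))" for v i by (cases v) (simp add: \<pi>'_def)
  let ?f = "\<lambda>(X, x). \<lambda>i\<in>Field I. (X, x i)"
  have "bij_betw ?f (SIGMA X:\<X>. closure (C X)) D.branches"
    unfolding bij_betw_def
  proof
    show "inj_on ?f (SIGMA X:\<X>. closure (C X))"
    proof (rule inj_onI, clarify)
      fix X x Y y
      assume x: "x \<in> closure (C X)" and y: "y \<in> closure (C Y)"
        and eq: "(\<lambda>i\<in>Field I. (X, x i)) = (\<lambda>i\<in>Field I. (Y, y i))"
      have "X = Y \<and> x i = y i" if "i \<in> Field I" for i
        using fun_cong[OF eq, of i] that by simp
      then show "X = Y \<and> x = y"
        using branches_ext[of x y] x y closure_branches nonempty by blast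
    qed
    show "?f ` (SIGMA X:\<X>. closure (C X)) = D.branches"
    proof
      have "?f (X, x) \<in> D.branches" if X: "X \<in> \<X>" and x: "x \<in> closure (C X)" for X x
        using X x branchesD(2)[of x] ltD closure_branches[of "C X"]
        by (auto simp: D.branches_def T'_iff \<pi>'_eq closure_def)
      then show "?f ` (SIGMA X:\<X>. closure (C X)) \<subseteq> D.branches" by auto
      show "D.branches \<subseteq> ?f ` (SIGMA X:\<X>. closure (C X))"
      proof
        fix y assume y: "y \<in> D.branches"
        then have yT: "\<And>i. i \<in> Field I \<Longrightarrow> y i \<in> T' i" and yp: "\<And>i j. i \<triangleleft> j \<Longrightarrow> y i = \<pi>' i (y j)"
          and ye: "y \<in> extensional (Field I)" by (auto simp: D.branches_def PiE_iff)
        obtain i0 where i0: "i0 \<in> Field I" using nonempty by blast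
        define X where "X = fst (y i0)"
        have X: "fst (y i) = X" if i: "i \<in> Field I" for i
        proof -
          obtain k where "i0 \<triangleleft> k" "i \<triangleleft> k" using above2[OF i0 i] by blast
          then show ?thesis using yp[of i0 k] yp[of i k] by (simp add: \<pi>'_eq X_def)
        qed
        have X\<X>: "X \<in> \<X>" using yT[OF i0] by (simp add: T'_iff X_def)
        define x where "x = (\<lambda>i\<in>Field I. snd (y i))"
        have xl: "x i \<in> lev (C X) i" if "i \<in> Field I" for i
          using yT[OF that] X[OF that] that by (simp add: T'_iff x_def)
        have "x i = \<pi> i (x j)" if ij: "i \<triangleleft> j" for i j
          using yp[OF ij] ltD[OF ij] by (simp add: \<pi>'_eq x_def)
        then have "x \<in> closure (C X)"
          using xl subsetD[OF lev_T[OF _ X\<X>] xl]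
          by (auto simp: closure_def branches_def PiE_iff) (simp add: x_def)
        moreover have "y = ?f (X, x)"
        proof
          fix i show "y i = ?f (X, x) i"
            using X[of i] ye by (cases "i \<in> Field I") (auto simp: x_def extensional_def prod_eq_iff)
        qed
        ultimately show "y \<in> ?f ` (SIGMA X:\<X>. closure (C X))" using X\<X> by blast
      qed
    qed
  qed
  then show "|D.branches| =o |SIGMA X:\<X>. closure (C X)|"
    using card_of_ordIso ordIso_symmetric by blast
qed

end

locale large_tree = tree I T \<pi> for I :: "'k rel" and T :: "'k \<Rightarrow> 'v set" and \<pi> +
  fixes M :: "'m set"
  assumes Pow_M: "|Pow (Field I)| \<le>o |M|" and M_branches: "|M| \<le>o |branches|"
begin

text \<open>
  Some family of at least \<open>|M|\<close> branches has its level sizes bounded by \<open>\<phi>\<close> on \<open>X\<close>.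
\<close>

definition good :: "'k set \<Rightarrow> ('k \<Rightarrow> 'v set) \<Rightarrow> bool" where
  "good X \<phi> \<longleftrightarrow> (\<exists>F \<subseteq> branches. |M| \<le>o |F| \<and> (\<forall>i\<in>X. |lev F i| \<le>o |\<phi> i| ))"

text \<open>
  Goodness is not preserved when two bounds, each good on its own set, are pasted together, since the
  witnessing families differ. Coverage by finitely many good sets, modulo a bounded set, is preserved.
\<close>

definition covered :: "'k set \<Rightarrow> ('k \<Rightarrow> 'v set) \<Rightarrow> bool" where
  "covered X \<phi> \<longleftrightarrow> (\<exists>\<X> B. finite \<X> \<and> (\<forall>Y\<in>\<X>. good Y \<phi>) \<and> bdd B \<and> X \<subseteq> \<Union>\<X> \<union> B)"

text \<open>
  The sets on which the bound \<open>\<phi>\<close> can be improved.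
\<close>

definition negligible :: "('k \<Rightarrow> 'v set) \<Rightarrow> 'k set \<Rightarrow> bool" where
  "negligible \<phi> X \<longleftrightarrow> (\<exists>\<phi>'. smaller_on X \<phi>' \<phi> \<and> covered X \<phi>')"

lemma negligible_mono: "negligible \<phi> Y \<Longrightarrow> X \<subseteq> Y \<Longrightarrow> negligible \<phi> X"
proof -
  assume "negligible \<phi> Y" and XY: "X \<subseteq> Y"
  then obtain \<phi>' where "smaller_on Y \<phi>' \<phi>" "covered Y \<phi>'" unfolding negligible_def by blast
  then have "smaller_on X \<phi>' \<phi>" "covered X \<phi>'"
    using XY unfolding smaller_on_def covered_def by (blast, meson subset_trans)
  then show "negligible \<phi> X" unfolding negligible_def by blast
qed

lemma negligible_bdd: "bdd X \<Longrightarrow> negligible \<phi> X"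
  unfolding negligible_def smaller_on_def covered_def
  by (intro exI[of _ \<phi>] conjI exI[of _ X] exI[of _ "{}"]) auto

lemma good_cong:
  assumes "good Y \<phi>" "X \<subseteq> Y" "\<And>i. i \<in> X \<Longrightarrow> \<psi> i = \<phi> i"
  shows "good X \<psi>"
  using assms unfolding good_def by (metis subsetD)

text \<open>
  Use one improved bound on \<open>X\<close> and the other on the rest.
\<close>

lemma negligible_Un:
  assumes X: "negligible \<phi> X" and Y: "negligible \<phi> Y"
  shows "negligible \<phi> (X \<union> Y)"
proof -
  obtain \<phi>1 B1 \<X>1 C1 where 1: "bdd B1" "\<And>i. i \<in> X - B1 \<Longrightarrow> |\<phi>1 i| <o |\<phi> i|"
    "finite \<X>1" "\<And>Z. Z \<in> \<X>1 \<Longrightarrow> good Z \<phi>1" "bdd C1" "X \<subseteq> \<Union>\<X>1 \<union> C1"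
    using X unfolding negligible_def smaller_on_def covered_def by blast
  obtain \<phi>2 B2 \<X>2 C2 where 2: "bdd B2" "\<And>i. i \<in> Y - B2 \<Longrightarrow> |\<phi>2 i| <o |\<phi> i|"
    "finite \<X>2" "\<And>Z. Z \<in> \<X>2 \<Longrightarrow> good Z \<phi>2" "bdd C2" "Y \<subseteq> \<Union>\<X>2 \<union> C2"
    using Y unfolding negligible_def smaller_on_def covered_def by blast
  define \<psi> where "\<psi> i = (if i \<in> X then \<phi>1 i else \<phi>2 i)" for i
  let ?Z = "(\<lambda>Z. Z \<inter> X) ` \<X>1 \<union> (\<lambda>Z. Z - X) ` \<X>2"
  have "smaller_on (X \<union> Y) \<psi> \<phi>"
    unfolding smaller_on_def
    using 1(2) 2(2) bdd_Un[OF 1(1) 2(1)] by (intro exI[of _ "B1 \<union> B2"]) (auto simp: \<psi>_def)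
  moreover have "good (Z \<inter> X) \<psi>" if "Z \<in> \<X>1" for Z
    by (rule good_cong[OF 1(4)[OF that]]) (auto simp: \<psi>_def)
  moreover have "good (Z - X) \<psi>" if "Z \<in> \<X>2" for Z
    by (rule good_cong[OF 2(4)[OF that]]) (auto simp: \<psi>_def)
  moreover have "X \<union> Y \<subseteq> \<Union>?Z \<union> (C1 \<union> C2)" using 1(6) 2(6) by auto
  ultimately show ?thesis
    unfolding negligible_def covered_def using 1(3) 2(3) bdd_Un[OF 1(5) 2(5)]
    by (intro exI[of _ \<psi>] conjI exI[of _ ?Z] exI[of _ "C1 \<union> C2"]) auto
qed

lemma negligible_Union: "finite \<X> \<Longrightarrow> (\<And>X. X \<in> \<X> \<Longrightarrow> negligible \<phi> X) \<Longrightarrow> negligible \<phi> (\<Union>\<X>)"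
  by (induction \<X> rule: finite_induct) (auto intro: negligible_bdd bdd_empty negligible_Un)

text \<open>
  For a bound \<open>\<phi>\<close> that is minimal among those covering the whole order, the negligible sets form a proper
  ideal. So one of the finitely many good sets that cover the order is not negligible.
\<close>

lemma minimal_family:
  obtains \<phi> S F where "S \<subseteq> Field I" "\<not> negligible \<phi> S" "F \<subseteq> branches" "|M| \<le>o |F|"
    "\<And>i. i \<in> S \<Longrightarrow> |lev F i| \<le>o |\<phi> i|"
proof -
  have "|lev branches i| \<le>o |T i|" if "i \<in> Field I" for i
    using branchesD(1) that by (intro card_of_mono1) (auto simp: lev_def)
  then have "good (Field I) T" unfolding good_def using M_branches by blast
  then have "covered (Field I) T"
    unfolding covered_def using bdd_empty by (intro exI[of _ "{Field I}"] exI[of _ "{}"]) auto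
  then obtain \<phi> where \<phi>: "covered (Field I) \<phi>" "\<And>\<psi>. smaller_on (Field I) \<psi> \<phi> \<Longrightarrow> \<not> covered (Field I) \<psi>"
    using wfE_min[OF wf_smaller_on, of T "{\<phi>. covered (Field I) \<phi>}"] by (metis (mono_tags, lifting) case_prodI mem_Collect_eq)
  then have nI: "\<not> negligible \<phi> (Field I)" unfolding negligible_def by blast
  obtain \<X> B where X: "finite \<X>" "\<And>Y. Y \<in> \<X> \<Longrightarrow> good Y \<phi>" "bdd B" "Field I \<subseteq> \<Union>\<X> \<union> B"
    using \<phi>(1) unfolding covered_def by blast
  let ?\<X> = "(\<lambda>Y. Y \<inter> Field I) ` \<X>"
  have fin: "finite ?\<X>" and sub: "Field I \<subseteq> \<Union>?\<X> \<union> B" using X(1,4) by auto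
  have "\<not> (\<forall>Y\<in>?\<X>. negligible \<phi> Y)"
    using nI negligible_mono[OF negligible_Un[OF negligible_Union[OF fin] negligible_bdd[OF X(3)]] sub]
    by blast
  then obtain Y where Y: "Y \<in> \<X>" "\<not> negligible \<phi> (Y \<inter> Field I)" by blast
  have "good (Y \<inter> Field I) \<phi>" by (rule good_cong[OF X(2)[OF Y(1)]]) auto
  then obtain F where "F \<subseteq> branches" "|M| \<le>o |F|" "\<forall>i\<in>Y \<inter> Field I. |lev F i| \<le>o |\<phi> i|"
    unfolding good_def by blast
  then show thesis using that[OF _ Y(2)] by blast
qed

text \<open>
  Let \<open>F\<close> be a closed family for the minimal bound on a set \<open>S\<close> which is not negligible. At each level the
  nodes of \<open>F\<close> are well-ordered in the type of their cardinality, so that the predecessors of a node are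
  strictly fewer than the bound. The branches \<open>f\<close> with \<open>below f g = X\<close> thus have at most \<open>|M|\<close> members,
  closure included, unless \<open>X\<close> is negligible; \<open>D g\<close> collects them for all other \<open>X\<close>. If \<open>F\<close> is larger than
  \<open>M\<close>, choose \<open>A\<close> of size \<open>|M|\<close> inside \<open>F\<close> and an \<open>f\<close> outside \<open>A\<close> and all \<open>D g\<close> for \<open>g\<close> in \<open>A\<close>; then \<open>D f\<close> contains
  all of \<open>A\<close>. The subtree sought is then the disjoint union of the closures of the pieces of \<open>D f\<close>, because no
  single piece need have size \<open>|M|\<close> when the cofinality of \<open>|M|\<close> is small.
\<close>

theorem subtree_with_prescribed_branches:
  "\<exists>(T' :: 'k \<Rightarrow> ('k set \<times> 'v) set) \<pi>'. tree I T' \<pi>' \<and>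
     (\<forall>i\<in>Field I. T' i \<subseteq> Pow (Field I) \<times> T i) \<and> |tree.branches I T' \<pi>'| =o |M|"
proof -
  obtain \<phi> S F0 where S: "S \<subseteq> Field I" "\<not> negligible \<phi> S" and F0: "F0 \<subseteq> branches" "|M| \<le>o |F0|"
    and small0: "\<And>i. i \<in> S \<Longrightarrow> |lev F0 i| \<le>o |\<phi> i|"
    by (rule minimal_family) blast
  define F where "F = closure F0"
  have F: "F \<subseteq> branches" unfolding F_def by (rule closure_branches)
  have MF: "|M| \<le>o |F|"
    using F0(2) card_of_mono1[OF subset_closure[OF F0(1)]] ordLeq_transitive unfolding F_def by blast
  have small: "|lev F i| \<le>o |\<phi> i|" if i: "i \<in> S" for i
    using card_of_mono1[OF lev_closure[of i F0]] small0[OF i] S(1) i ordLeq_transitive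
    unfolding F_def by blast
  have "infinite (Field I)"
    using above_countable[OF order_refl] countable_finite[of "Field I"] lt_irrefl by blast
  then have infM: "infinite M"
    using card_of_ordLeq_finite[OF Pow_M] by auto
  have result: ?thesis if "\<And>X. X \<in> \<X> \<Longrightarrow> C X \<subseteq> branches" "\<X> \<subseteq> Pow (Field I)"
    "|SIGMA X:\<X>. closure (C X)| =o |M|" for \<X> C
    using disjoint_union_tree[of \<X> C, OF that(1)] that(2,3) ordIso_transitive
    by (intro exI conjI) (assumption, blast+)
  show ?thesis
  proof (cases "|F| \<le>o |M|")
    case True
    have "{{}} \<times> F = (\<lambda>x. ({}, x)) ` F" by auto
    then have FF: "|{{} :: 'k set} \<times> F| =o |F|"
      using card_of_ordIso[of F "{{}} \<times> F"] ordIso_symmetric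
      by (metis bij_betw_imageI inj_onI prod.inject)
    have "|F| =o |M|" using True MF by (simp add: ordIso_iff_ordLeq)
    with FF have "|SIGMA X:{{} :: 'k set}. closure F0| =o |M|"
      unfolding F_def by (rule ordIso_transitive)
    then show ?thesis using F0(1) by (intro result[of "{{}}" "\<lambda>_. F0"]) auto
  next
    case False
    define r where "r i = |lev F i|" for i
    define below where "below f g = {i \<in> S. (f i, g i) \<in> r i \<and> f i \<noteq> g i}" for f g :: "'k \<Rightarrow> 'v"
    define piece where "piece g X = {f \<in> F. below f g = X}" for g X
    define \<X> where "\<X> = {X. X \<subseteq> S \<and> \<not> negligible \<phi> X}"
    define D where "D g = (\<Union>X\<in>\<X>. piece g X)" for g
    have piece_branches: "piece g X \<subseteq> branches" for g X using F by (auto simp: piece_def)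
    have rfield: "Field (r i) = lev F i" for i by (simp add: r_def Field_card_of)
    have piece_small: "|closure (piece g X)| \<le>o |M|" if g: "g \<in> F" and X: "X \<in> \<X>" for g X
    proof (rule ccontr)
      let ?P = "piece g X"
      assume "\<not> |closure ?P| \<le>o |M|"
      then have big: "|M| \<le>o |closure ?P|" using card_of_le_cases ordLess_imp_ordLeq by blast
      have "X \<subseteq> S" using X by (simp add: \<X>_def)
      have "|lev ?P i| <o |\<phi> i|" if i: "i \<in> X" for i
      proof -
        have "lev ?P i \<subseteq> underS (r i) (g i)"
          using i by (auto simp: lev_def piece_def below_def underS_def)
        then have "|lev ?P i| \<le>o |underS (r i) (g i)|" by (rule card_of_mono1)
        also have "|underS (r i) (g i)| <o r i"
          using g unfolding r_def by (intro card_of_underS card_of_Card_order) (auto simp: Field_card_of lev_def)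
        also have "r i \<le>o |\<phi> i|" using small i \<open>X \<subseteq> S\<close> unfolding r_def by blast
        finally show ?thesis .
      qed
      note lt = this
      have smaller: "smaller_on X (lev ?P) \<phi>"
        unfolding smaller_on_def using lt bdd_empty by (intro exI[of _ "{}"]) simp
      have "|lev (closure ?P) i| \<le>o |lev ?P i|" if "i \<in> X" for i
        using that \<open>X \<subseteq> S\<close> S(1) by (intro card_of_mono1 lev_closure) blast
      then have "good X (lev ?P)"
        unfolding good_def using closure_branches big by (intro exI[of _ "closure ?P"]) simp
      then have "covered X (lev ?P)"
        unfolding covered_def using bdd_empty by (intro exI[of _ "{X}"] exI[of _ "{}"]) auto
      with smaller show False using X unfolding \<X>_def negligible_def by blast
    qed
    have \<X>_Pow: "\<X> \<subseteq> Pow (Field I)" using S(1) by (auto simp: \<X>_def)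
    have "|\<X>| \<le>o |M|" by (rule ordLeq_transitive[OF card_of_mono1[OF \<X>_Pow] Pow_M])
    then have sigma: "|SIGMA X:\<X>. closure (piece g X)| \<le>o |M|" if "g \<in> F" for g
      by (rule card_of_Sigma_ordLeq_infinite[OF infM]) (use piece_small[OF that] in blast)
    have D_sigma: "|D g| \<le>o |SIGMA X:\<X>. closure (piece g X)|" for g
      using subset_closure[OF piece_branches]
      by (intro surj_imp_ordLeq[of _ snd]) (force simp: D_def image_iff)
    have tri: "f \<in> D g \<or> g \<in> D f" if f: "f \<in> F" and g: "g \<in> F" and "f \<noteq> g" for f g
    proof -
      obtain i0 where i0: "i0 \<in> Field I" "f i0 \<noteq> g i0"
        using branches_ext[of f g] f g F \<open>f \<noteq> g\<close> by blast
      obtain j where j: "i0 \<triangleleft> j" using above2[OF i0(1) i0(1)] by blast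
      have "i \<triangleleft> j" if i: "i \<in> S" "f i = g i" for i
      proof -
        have "\<not> i0 \<triangleleft> i"
        proof
          assume "i0 \<triangleleft> i"
          then have "f i0 = \<pi> i0 (f i)" "g i0 = \<pi> i0 (g i)"
            using branchesD(2) f g F by blast+
          then show False using i(2) i0(2) by simp
        qed
        then show ?thesis using lt_linear[OF i0(1), of i] i S(1) j lt_trans by blast
      qed
      then have eq: "bdd {i \<in> S. f i = g i}" unfolding bdd_def using ltD(2)[OF j] by blast
      have "(f i, g i) \<in> r i \<or> (g i, f i) \<in> r i" if "f i \<noteq> g i" for i
      proof -
        have "total_on (lev F i) (r i)"
          unfolding r_def using card_of_well_order_on by (auto simp: order_on_defs)
        then show ?thesis using that f g unfolding total_on_def lev_def by blast
      qed
      then have sub: "S \<subseteq> below f g \<union> below g f \<union> {i \<in> S. f i = g i}"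
        unfolding below_def by auto
      have "\<not> (negligible \<phi> (below f g) \<and> negligible \<phi> (below g f))"
        using S(2) negligible_mono[OF negligible_Un[OF negligible_Un negligible_bdd[OF eq]] sub] by blast
      then show ?thesis
        using f g unfolding D_def \<X>_def piece_def by (auto simp: below_def)
    qed
    obtain e where e: "inj_on e M" "e ` M \<subseteq> F" using MF unfolding card_of_ordLeq[symmetric] by blast
    define A where "A = e ` M"
    have "bij_betw e M A" using e(1) unfolding A_def by (rule inj_on_imp_bij_betw)
    then have A: "A \<subseteq> F" "|M| =o |A|" using e(2) card_of_ordIso unfolding A_def by blast+
    have AM: "|A| \<le>o |M|" using A(2) ordIso_symmetric ordIso_imp_ordLeq by blast
    have "|A \<union> (\<Union>g\<in>A. D g)| \<le>o |M|"
    proof (rule Un_Cinfinite_bound[OF AM])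
      show "|\<Union>g\<in>A. D g| \<le>o |M|"
      proof (rule UNION_Cinfinite_bound[OF AM], rule ballI)
        show "|D g| \<le>o |M|" if "g \<in> A" for g
          using that A(1) by (intro ordLeq_transitive[OF D_sigma sigma]) blast
      qed (rule Cinfinite_card_of[OF infM])
    qed (rule Cinfinite_card_of[OF infM])
    then have "\<not> F \<subseteq> A \<union> (\<Union>g\<in>A. D g)"
      using False ordLeq_transitive[OF card_of_mono1] by blast
    then obtain f where f: "f \<in> F" "f \<notin> A" "\<And>g. g \<in> A \<Longrightarrow> f \<notin> D g" by blast
    have "A \<subseteq> D f" using tri[OF f(1)] f A(1) by blast
    then have "|M| \<le>o |D f|" by (rule ordIso_ordLeq_trans[OF A(2) card_of_mono1])
    then have "|SIGMA X:\<X>. closure (piece f X)| =o |M|"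
      using sigma[OF f(1)] ordLeq_transitive[OF _ D_sigma[of f]] unfolding ordIso_iff_ordLeq by simp
    then show ?thesis using piece_branches \<X>_Pow by (intro result[of \<X> "piece f"]) auto
  qed
qed

end

section \<open>Cardinalities of quotient limits\<close>

text \<open>
  The constant system of the integers modulo \<open>n\<close>, presented as integers with \<open>q i x = x mod n\<close>.
\<close>

lemma (in uncountable_cofinality) finite_quotient_limit:
  fixes r :: "'a rel" and n :: nat
  assumes r: "Card_order r" "natLeq <o r" and Ir: "|Field I| <o r" and n: "n > 0"
  shows "\<exists>(G :: 'k \<Rightarrow> 'a monoid) h. inverse_system I G h \<and>
           (\<forall>i\<in>Field I. |carrier (G i)| <o r) \<and> |carrier (quotient_limit I G h)| =o |{..<n}|"
proof -
  interpret C: coefficient_system I "\<lambda>_. UNIV :: int set" "\<lambda>_ x. x" "\<lambda>_ x. x mod int n"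
    by unfold_locales (auto simp: mod_eq_dvd_iff mod_eq_0_iff_dvd)
  have "|UNIV :: int set| \<le>o natLeq"
    by (rule countable_ordLeq_infinite[OF _ natLeq_Cinfinite]) simp
  then have Z: "|UNIV :: int set| <o r" using r(2) by (rule ordLeq_ordLess_trans)
  let ?f = "\<lambda>m. \<lambda>i\<in>Field I. int m"
  have "bij_betw ?f {..<n} C.limit_set"
    unfolding bij_betw_def
  proof
    show "inj_on ?f {..<n}"
      using nonempty by (intro inj_onI) (metis ex_in_conv of_nat_eq_iff restrict_apply')
    show "?f ` {..<n} = C.limit_set"
    proof
      show "?f ` {..<n} \<subseteq> C.limit_set"
      proof
        fix x assume "x \<in> ?f ` {..<n}"
        then obtain m where m: "m < n" "x = ?f m" by blast
        then show "x \<in> C.limit_set" unfolding C.limit_set_def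
          by (intro CollectI exI[of _ "\<lambda>_. int m"]) (auto intro: restrict_ext)
      qed
      show "C.limit_set \<subseteq> ?f ` {..<n}"
      proof
        fix x assume "x \<in> C.limit_set"
        then obtain c where x: "x = (\<lambda>i\<in>Field I. c i mod int n)"
          and c: "\<And>i j. i \<triangleleft> j \<Longrightarrow> c i mod int n = c j mod int n"
          unfolding C.limit_set_def by blast
        obtain i0 where i0: "i0 \<in> Field I" using nonempty by blast
        have "c i mod int n = c i0 mod int n" if "i \<in> Field I" for i
          using above2[OF that i0] c by metis
        then have "x = ?f (nat (c i0 mod int n))"
          unfolding x using n by (intro restrict_ext) simp
        moreover have "nat (c i0 mod int n) < n" using n by (simp add: nat_less_iff)
        ultimately show "x \<in> ?f ` {..<n}" by blast
      qed
    qed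
  qed
  then have "|C.limit_set| =o |{..<n}|" using card_of_ordIso ordIso_symmetric by blast
  then show ?thesis
    using C.quotient_limit_realises_limit[OF r Ir Z] ordIso_transitive by blast
qed

theorem mainTheorem1:
  fixes lam :: "'a rel" and kap :: "'k rel" and mu :: "'m rel"
  assumes lam: "Card_order lam"
    and kap: "Card_order kap"
    and cf: "cf lam =o kap"
    and singular: "kap <o lam"
    and uncountable: "natLeq <o kap"
    and mu: "Card_order mu"
  shows "(\<not> mu =o (czero :: 'm rel) \<and> mu \<le>o lam \<longrightarrow>
            (\<exists>(G :: 'k \<Rightarrow> 'a monoid) h. inverse_system kap G h \<and>
               (\<forall>i \<in> Field kap. |carrier (G i)| <o lam) \<and>
               |carrier (quotient_limit kap G h)| =o mu))
       \<and> (ctwo ^c kap <o lam \<and>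
          (\<forall>theta :: 'a rel. Card_order theta \<and> theta <o lam \<longrightarrow> cexp_less theta kap <o lam) \<and>
          lam <o mu \<and> mu \<le>o lam ^c kap \<longrightarrow>
            (\<exists>(G :: 'k \<Rightarrow> 'a monoid) h. inverse_system kap G h \<and>
               (\<forall>i \<in> Field kap. |carrier (G i)| <o lam) \<and>
               |carrier (quotient_limit kap G h)| =o mu))"
proof -
  interpret uncountable_cofinality kap
    by (rule cofinality_filtration(1)[OF lam kap cf singular uncountable])
  obtain L where L_props: "\<forall>i\<in>Field kap. L i \<subseteq> Field lam \<and> |L i| <o lam"
    "\<forall>i j. (i, j) \<in> kap \<longrightarrow> L i \<subseteq> L j" and L_cover: "(\<Union>i\<in>Field kap. L i) = Field lam"
    using cofinality_filtration(2)[OF lam kap cf singular uncountable] by (elim exE conjE)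
  have L: "|L i| <o lam" if "i \<in> Field kap" for i using L_props(1) that by blast
  have L_mono: "L i \<subseteq> L j" if "lt i j" for i j using L_props(2) that by (simp add: lt_def)
  have lam_unc: "natLeq <o lam" by (rule ordLess_transitive[OF uncountable singular])
  have lam_inf: "Cinfinite lam"
    using lam lam_unc cinfinite_mono[OF ordLess_imp_ordLeq natLeq_cinfinite] by blast
  have Ir: "|Field kap| <o lam"
    by (rule ordIso_ordLess_trans[OF card_of_Field_ordIso[OF kap] singular])
  have muF: "|Field mu| =o mu" by (rule card_of_Field_ordIso[OF mu])
  have insert_small: "|insert z (X \<inter> L i)| <o lam" if i: "i \<in> Field kap" for X z i
  proof -
    have "|{z}| <o lam"
      using Cfinite_ordLess_Cinfinite[of "|{z}|" lam] lam_inf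
      by (simp add: cfinite_def card_of_card_order_on Field_card_of)
    moreover have "|X \<inter> L i| <o lam"
      by (rule ordLeq_ordLess_trans[OF card_of_mono1 L[OF i]]) blast
    ultimately have "|{z} \<union> X \<inter> L i| <o lam"
      using Un_Cinfinite_bound_strict lam_inf by blast
    then show ?thesis by simp
  qed
  let ?goal = "\<exists>(G :: 'k \<Rightarrow> 'a monoid) h. inverse_system kap G h \<and>
               (\<forall>i \<in> Field kap. |carrier (G i)| <o lam) \<and>
               |carrier (quotient_limit kap G h)| =o mu"
  have goalI: ?goal if "\<exists>(G :: 'k \<Rightarrow> 'a monoid) h. inverse_system kap G h \<and>
               (\<forall>i \<in> Field kap. |carrier (G i)| <o lam) \<and>
               |carrier (quotient_limit kap G h)| =o |Y|" and "|Y| =o mu" for Y :: "'y set"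
    using that ordIso_transitive by blast
  have small: ?goal if nz: "\<not> mu =o (czero :: 'm rel)" and le: "mu \<le>o lam"
  proof (cases "finite (Field mu)")
    case True
    have "Field mu \<noteq> {}" using nz czeroI[OF mu] by blast
    then have "card (Field mu) > 0" using True by (simp add: card_gt_0_iff)
    moreover have "|{..<card (Field mu)}| =o |Field mu|"
      using True card_of_ordIso finite_same_card_bij[of "{..<card (Field mu)}" "Field mu"] by auto
    then have "|{..<card (Field mu)}| =o mu" using muF by (rule ordIso_transitive)
    ultimately show ?thesis
      by (intro goalI[OF finite_quotient_limit[OF lam lam_unc Ir]])
  next
    case False
    have "|Field mu| \<le>o |Field lam|"
      using le card_of_mono2 by blast
    then obtain g where g: "inj_on g (Field mu)" "g ` Field mu \<subseteq> Field lam"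
      unfolding card_of_ordLeq[symmetric] by blast
    define M where "M = g ` Field mu"
    have "bij_betw g (Field mu) M" using g(1) unfolding M_def by (rule inj_on_imp_bij_betw)
    then have "|Field mu| =o |M|" using card_of_ordIso by blast
    then have M_mu: "|M| =o mu" using muF ordIso_symmetric ordIso_transitive by blast
    have M_inf: "infinite M" using False g(1) finite_imageD unfolding M_def by blast
    then obtain z where z: "z \<in> M" by fastforce
    have cov: "M \<subseteq> (\<Union>i\<in>Field kap. L i)" using g(2) L_cover unfolding M_def by simp
    interpret tree kap "\<lambda>i. insert z (M \<inter> L i)" "\<lambda>i x. if x \<in> L i then x else z"
      by (rule filtration_tree(1)[OF L_mono cov z])
    have br: "|branches| =o |M|" by (rule filtration_tree(2)[OF L_mono cov z])
    then have inf: "infinite branches" using M_inf card_of_ordIso_finite by blast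
    show ?thesis
      by (rule goalI[OF quotient_limit_counts_branches[OF lam lam_unc Ir insert_small inf]
            ordIso_transitive[OF br M_mu]])
  qed
  have large: ?goal if two: "ctwo ^c kap <o lam"
    and weak: "\<And>theta :: 'a rel. Card_order theta \<Longrightarrow> theta <o lam \<Longrightarrow> cexp_less theta kap <o lam"
    and lt: "lam <o mu" and le: "mu \<le>o lam ^c kap"
  proof -
    \<comment> \<open>The default value of truncated functions may be any element, in a filtration piece or not.\<close>
    fix z :: 'a
    let ?T = "\<lambda>i. {t. (\<forall>s. lt s i \<longrightarrow> t s \<in> insert z (L i)) \<and> (\<forall>s. \<not> lt s i \<longrightarrow> t s = z)}"
    let ?\<pi> = "\<lambda>i t s. if lt s i \<and> t s \<in> L i then t s else z"
    have cov: "Field lam \<subseteq> (\<Union>i\<in>Field kap. L i)" using L_cover by simp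
    note ft = function_tree[OF L_mono cov, where z = z]
    interpret B: tree kap ?T ?\<pi> by (rule ft(1))
    have Pow2: "|Pow (Field kap)| =o ctwo ^c kap"
      using card_of_Pow_Func unfolding cexp_def ctwo_def Field_card_of by blast
    have Pow_lam: "|Pow (Field kap)| <o lam" by (rule ordIso_ordLess_trans[OF Pow2 two])
    have mu_F: "mu =o |Field mu|" by (rule ordIso_symmetric[OF muF])
    have lam_M: "lam \<le>o |Field mu|"
      by (rule ordLeq_ordIso_trans[OF ordLess_imp_ordLeq[OF lt] mu_F])
    interpret B: large_tree kap ?T ?\<pi> "Field mu"
    proof unfold_locales
      show "|Pow (Field kap)| \<le>o |Field mu|"
        by (rule ordLeq_transitive[OF ordLess_imp_ordLeq[OF Pow_lam] lam_M])
      have "|Field mu| \<le>o lam ^c kap" by (rule ordIso_ordLeq_trans[OF muF le])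
      then show "|Field mu| \<le>o |B.branches|"
        using ft(2) ordLeq_transitive unfolding cexp_def by blast
    qed
    obtain T' :: "'k \<Rightarrow> ('k set \<times> ('k \<Rightarrow> 'a)) set" and \<pi>' where T': "tree kap T' \<pi>'"
      "\<And>i. i \<in> Field kap \<Longrightarrow> T' i \<subseteq> Pow (Field kap) \<times> ?T i" "|tree.branches kap T' \<pi>'| =o |Field mu|"
      using B.subtree_with_prescribed_branches by blast
    interpret T': tree kap T' \<pi>' by (rule T'(1))
    have T_small: "|?T i| <o lam" if i: "i \<in> Field kap" for i
    proof -
      let ?th = "|insert z (L i)|" and ?n = "|underS kap i|"
      have "cexp_less ?th kap <o lam"
        using weak[OF card_of_Card_order] insert_small[OF i, of z UNIV] by simp
      moreover have "?th ^c ?n \<le>o cexp_less ?th kap"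
        unfolding cexp_less_def
        by (rule csup_upper)
          (use Card_order_cexp card_of_Card_order card_of_underS[OF kap i] in blast)+
      moreover have "|?T i| \<le>o ?th ^c ?n"
        using ft(3)[of i] unfolding cexp_def Field_card_of .
      ultimately show ?thesis by (meson ordLeq_ordLess_trans)
    qed
    have T'_small: "|T' i| <o lam" if i: "i \<in> Field kap" for i
      by (rule ordLeq_ordLess_trans[OF card_of_mono1[OF T'(2)[OF i]]])
        (rule card_of_Times_ordLess[OF Pow_lam T_small[OF i] lam_inf])
    have "Cinfinite |Field mu|"
      using lam_M lam_inf cinfinite_mono[OF lam_M] card_of_Card_order by blast
    then have "infinite (Field mu)" by (simp add: cinfinite_def Field_card_of)
    then have inf: "infinite T'.branches" using T'(3) card_of_ordIso_finite by blast
    show ?thesis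
      by (rule goalI[OF T'.quotient_limit_counts_branches[OF lam lam_unc Ir T'_small inf]
            ordIso_transitive[OF T'(3) muF]])
  qed
  show ?thesis using small large by blast
qed

end
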